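(* There exists a locally compact Polish non-archimedean group $G$ such that the $G$-space $G_c$, i.e. $G$ with the conjugation action $G \times G \to G$, $(g,x) \mapsto gxg^{-1}$, is not Rosenthal representable.
   Context: All topological spaces are assumed to be Tychonoff. A topological group is non-archimedean if its open subgroups form a local basis at the identity. For a topological group $G$, a $G$-space is a topological space $X$ with a continuous action $G \times X \to X$. For a Banach space $V$, $\mathrm{Iso}(V)$ is the topological group of linear isometries of $V$ onto itself with the strong operator topology; it acts on the dual $V^*$ by $(gu^* )(v) = u^*(g^{-1}v)$. A representation of a $G$-space $X$ on $V$ is a pair $(h,\alpha)$ where $h \colon G \to \mathrm{Iso}(V)$ is a continuous homomorphism and $\alpha \colon X \to V^*$ is a norm-bounded, weak-star continuous map that is equivariant: $\alpha(gx) = h(g)\alpha(x)$ for all $g \in G$, $x \in X$. The representation is proper if $\alpha$ is a topological embedding (with $V^*$ carrying the weak-star topology). A Banach space $V$ is called a Rosenthal space if it does not contain an isomorphic copy of $l_1$ (equivalently, every bounded sequence in $V$ has a weak-Cauchy subsequence). A $G$-space (or its action) is Rosenthal representable if it admits a proper representation on some Rosenthal Banach space $V$. *)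

theory Defs
  imports "HOL-Analysis.Analysis" "HOL-Algebra.Group_Action" "HOL-Algebra.Module"
begin

section \<open>Topological groups and their actions\<close>

definition tychonoff_space :: "'a topology \<Rightarrow> bool" where
  "tychonoff_space T \<longleftrightarrow> completely_regular_space T \<and> Hausdorff_space T"

definition Polish_space :: "'a topology \<Rightarrow> bool" where
  "Polish_space T \<longleftrightarrow> separable_space T \<and> completely_metrizable_space T"

locale topological_group = group G for G (structure) +
  fixes T :: "'a topology"
  assumes topspace_eq_carrier: "topspace T = carrier G"
    and tychonoff: "tychonoff_space T"
    and continuous_mult: "continuous_map (prod_topology T T) T (\<lambda>(x, y). x \<otimes> y)"
    and continuous_inv: "continuous_map T T (\<lambda>x. inv x)"

definition non_archimedean :: "('a, 'b) monoid_scheme \<Rightarrow> 'a topology \<Rightarrow> bool" where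
  "non_archimedean G T \<longleftrightarrow>
     (\<forall>U. openin T U \<and> \<one>\<^bsub>G\<^esub> \<in> U \<longrightarrow> (\<exists>H. subgroup H G \<and> openin T H \<and> H \<subseteq> U))"

locale G_space = topological_group G T + group_action G "topspace X" \<phi>
  for G (structure) and T :: "'a topology" and X :: "'x topology" and \<phi> +
  assumes tychonoff_X: "tychonoff_space X"
    and continuous_action: "continuous_map (prod_topology T X) X (\<lambda>(g, x). \<phi> g x)"

definition conjugation :: "('a, 'b) monoid_scheme \<Rightarrow> 'a \<Rightarrow> 'a \<Rightarrow> 'a" where
  "conjugation G g = (\<lambda>x\<in>carrier G. g \<otimes>\<^bsub>G\<^esub> x \<otimes>\<^bsub>G\<^esub> inv\<^bsub>G\<^esub> g)"

lemma (in topological_group) G_space_conjugation: "G_space G T T (conjugation G)"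
proof -
  interpret A: group_action G "topspace T" "conjugation G"
    using action_by_conjugation unfolding conjugation_def topspace_eq_carrier .
  have mult: "continuous_map Z T (\<lambda>z. f z \<otimes> g z)"
    if "continuous_map Z T f" "continuous_map Z T g" for Z :: "('a \<times> 'a) topology" and f g
    using continuous_map_compose[OF continuous_map_pairedI[OF that] continuous_mult]
    by (simp add: o_def)
  have "continuous_map (prod_topology T T) T (\<lambda>p. fst p \<otimes> snd p \<otimes> inv (fst p))"
    using continuous_map_compose[OF continuous_map_fst continuous_inv]
    by (intro mult continuous_map_fst continuous_map_snd) (simp add: o_def)
  then have "continuous_map (prod_topology T T) T (\<lambda>(g, x). conjugation G g x)"
    by (rule continuous_map_eq)
       (auto simp: conjugation_def topspace_eq_carrier)
  then show ?thesis
    using tychonoff by unfold_locales auto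
qed


section \<open>Banach spaces\<close>

text \<open>
  Banach spaces are real and live on carrier sets, so that one can quantify over them inside a
  formula. The record fields \<open>mult\<close> and \<open>one\<close>, which \<^locale>\<open>module\<close> inherits from rings, are junk.
\<close>

definition real_ring :: "real ring" where
  "real_ring = \<lparr>carrier = UNIV, mult = (*), one = 1, zero = 0, add = (+)\<rparr>"

record 'v normed_space = "(real, 'v) module" +
  vnorm :: "'v \<Rightarrow> real"

locale real_normed_space = module real_ring V for V :: "'v normed_space" (structure) +
  assumes vnorm_eq_0: "x \<in> carrier V \<Longrightarrow> vnorm V x = 0 \<longleftrightarrow> x = \<zero>"
    and vnorm_triangle:
      "\<lbrakk>x \<in> carrier V; y \<in> carrier V\<rbrakk> \<Longrightarrow> vnorm V (x \<oplus> y) \<le> vnorm V x + vnorm V y"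
    and vnorm_smult: "x \<in> carrier V \<Longrightarrow> vnorm V (r \<odot> x) = \<bar>r\<bar> * vnorm V x"

text \<open>
  The distance is 0 off the carrier because \<^locale>\<open>Metric_space\<close> wants a symmetric,
  nonnegative function on the whole type.
\<close>

definition vdist :: "'v normed_space \<Rightarrow> 'v \<Rightarrow> 'v \<Rightarrow> real" where
  "vdist V x y = (if x \<in> carrier V \<and> y \<in> carrier V then vnorm V (x \<ominus>\<^bsub>V\<^esub> y) else 0)"

definition norm_topology :: "'v normed_space \<Rightarrow> 'v topology" where
  "norm_topology V = Metric_space.mtopology (carrier V) (vdist V)"

definition banach_space :: "'v normed_space \<Rightarrow> bool" where
  "banach_space V \<longleftrightarrow> real_normed_space V \<and> Metric_space.mcomplete (carrier V) (vdist V)"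

definition linear_maps :: "'v normed_space \<Rightarrow> 'w normed_space \<Rightarrow> ('v \<Rightarrow> 'w) set" where
  "linear_maps V W = {S \<in> carrier V \<rightarrow> carrier W.
     (\<forall>x\<in>carrier V. \<forall>y\<in>carrier V. S (x \<oplus>\<^bsub>V\<^esub> y) = S x \<oplus>\<^bsub>W\<^esub> S y) \<and>
     (\<forall>r. \<forall>x\<in>carrier V. S (r \<odot>\<^bsub>V\<^esub> x) = r \<odot>\<^bsub>W\<^esub> S x)}"

definition contains_isomorphic_copy :: "'v normed_space \<Rightarrow> 'w normed_space \<Rightarrow> bool" where
  "contains_isomorphic_copy V W \<longleftrightarrow>
     (\<exists>S\<in>linear_maps W V. \<exists>c>0. \<exists>C.
        \<forall>x\<in>carrier W. c * vnorm W x \<le> vnorm V (S x) \<and> vnorm V (S x) \<le> C * vnorm W x)"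

definition l1_space :: "(nat \<Rightarrow> real) normed_space" where
  "l1_space = \<lparr>carrier = {a. summable (\<lambda>n. \<bar>a n\<bar>)}, mult = undefined, one = undefined,
     zero = (\<lambda>n. 0), add = (\<lambda>a b n. a n + b n), smult = (\<lambda>r a n. r * a n),
     vnorm = (\<lambda>a. \<Sum>n. \<bar>a n\<bar>)\<rparr>"

definition rosenthal_space :: "'v normed_space \<Rightarrow> bool" where
  "rosenthal_space V \<longleftrightarrow> banach_space V \<and> \<not> contains_isomorphic_copy V l1_space"


section \<open>The dual space and the isometry group\<close>

text \<open>
  Functionals and isometries are extensional functions, so that equality in the dual and in the
  isometry group is equality on the carrier, and both the weak-star and the strong operator
  topology are subspaces of a product topology.
\<close>

definition dual :: "'v normed_space \<Rightarrow> ('v \<Rightarrow> real) set" where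
  "dual V = {u \<in> extensional (carrier V).
     (\<forall>x\<in>carrier V. \<forall>y\<in>carrier V. u (x \<oplus>\<^bsub>V\<^esub> y) = u x + u y) \<and>
     (\<forall>r. \<forall>x\<in>carrier V. u (r \<odot>\<^bsub>V\<^esub> x) = r * u x) \<and>
     (\<exists>C. \<forall>x\<in>carrier V. \<bar>u x\<bar> \<le> C * vnorm V x)}"

definition dual_norm :: "'v normed_space \<Rightarrow> ('v \<Rightarrow> real) \<Rightarrow> real" where
  "dual_norm V u = (SUP x\<in>{x \<in> carrier V. vnorm V x \<le> 1}. \<bar>u x\<bar>)"

definition weak_star_topology :: "'v normed_space \<Rightarrow> ('v \<Rightarrow> real) topology" where
  "weak_star_topology V = subtopology (powertop_real (carrier V)) (dual V)"

definition linear_isometries :: "'v normed_space \<Rightarrow> ('v \<Rightarrow> 'v) set" where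
  "linear_isometries V =
     {S \<in> Bij (carrier V) \<inter> linear_maps V V. \<forall>x\<in>carrier V. vnorm V (S x) = vnorm V x}"

definition iso_group :: "'v normed_space \<Rightarrow> ('v \<Rightarrow> 'v) monoid" where
  "iso_group V = (BijGroup (carrier V))\<lparr>carrier := linear_isometries V\<rparr>"

definition strong_operator_topology :: "'v normed_space \<Rightarrow> ('v \<Rightarrow> 'v) topology" where
  "strong_operator_topology V =
     subtopology (product_topology (\<lambda>_. norm_topology V) (carrier V)) (linear_isometries V)"

definition dual_action :: "'v normed_space \<Rightarrow> ('v \<Rightarrow> 'v) \<Rightarrow> ('v \<Rightarrow> real) \<Rightarrow> 'v \<Rightarrow> real" where
  "dual_action V S u = (\<lambda>v\<in>carrier V. u ((inv\<^bsub>iso_group V\<^esub> S) v))"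


section \<open>Representations\<close>

definition representation ::
    "('g, 'm) monoid_scheme \<Rightarrow> 'g topology \<Rightarrow> 'x topology \<Rightarrow> ('g \<Rightarrow> 'x \<Rightarrow> 'x) \<Rightarrow>
     'v normed_space \<Rightarrow> ('g \<Rightarrow> 'v \<Rightarrow> 'v) \<Rightarrow> ('x \<Rightarrow> 'v \<Rightarrow> real) \<Rightarrow> bool" where
  "representation G T X \<phi> V h \<alpha> \<longleftrightarrow>
     h \<in> hom G (iso_group V) \<and>
     continuous_map T (strong_operator_topology V) h \<and>
     continuous_map X (weak_star_topology V) \<alpha> \<and>
     (\<exists>C. \<forall>x\<in>topspace X. dual_norm V (\<alpha> x) \<le> C) \<and>
     (\<forall>g\<in>carrier G. \<forall>x\<in>topspace X. \<alpha> (\<phi> g x) = dual_action V (h g) (\<alpha> x))"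

definition proper_representation ::
    "('g, 'm) monoid_scheme \<Rightarrow> 'g topology \<Rightarrow> 'x topology \<Rightarrow> ('g \<Rightarrow> 'x \<Rightarrow> 'x) \<Rightarrow>
     'v normed_space \<Rightarrow> ('g \<Rightarrow> 'v \<Rightarrow> 'v) \<Rightarrow> ('x \<Rightarrow> 'v \<Rightarrow> real) \<Rightarrow> bool" where
  "proper_representation G T X \<phi> V h \<alpha> \<longleftrightarrow>
     representation G T X \<phi> V h \<alpha> \<and> embedding_map X (weak_star_topology V) \<alpha>"

text \<open>
  HOL cannot quantify over the type underlying a Banach space, so the definition of Rosenthal
  representability quantifies over all Banach spaces carried by subsets of one type, which is
  large enough for every \<open>G\<close>-space on the given types: by \<open>rosenthal_representableI\<close> below,
  a proper representation on a Rosenthal space over an \<^emph>\<open>arbitrary\<close> type yields one over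
  this type.
\<close>

type_synonym ('g, 'x) universe = "nat \<Rightarrow> (real \<times> 'g \<times> 'x \<times> 'x set \<times> nat) list"

definition rosenthal_representable ::
    "('g, 'm) monoid_scheme \<Rightarrow> 'g topology \<Rightarrow> 'x topology \<Rightarrow> ('g \<Rightarrow> 'x \<Rightarrow> 'x) \<Rightarrow> bool" where
  "rosenthal_representable G T X \<phi> \<longleftrightarrow>
     (\<exists>(V :: ('g, 'x) universe normed_space) h \<alpha>.
        rosenthal_space V \<and> proper_representation G T X \<phi> V h \<alpha>)"


section \<open>Independence of the universe\<close>

lemma cring_real_ring: "cring real_ring"
proof (rule cringI)
  show "abelian_group real_ring"
  proof (rule abelian_groupI)
    show "\<exists>y\<in>carrier real_ring. y \<oplus>\<^bsub>real_ring\<^esub> x = \<zero>\<^bsub>real_ring\<^esub>" for x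
      by (rule bexI[of _ "- x"]) (auto simp: real_ring_def)
  qed (auto simp: real_ring_def)
  show "comm_monoid real_ring"
    by (rule comm_monoidI) (auto simp: real_ring_def)
qed (auto simp: real_ring_def algebra_simps)

lemma real_normed_spaceI:
  fixes V :: "'v normed_space" (structure)
  assumes "abelian_group V"
    and "\<And>r x. x \<in> carrier V \<Longrightarrow> r \<odot> x \<in> carrier V"
    and "\<And>r s x. x \<in> carrier V \<Longrightarrow> (r + s) \<odot> x = r \<odot> x \<oplus> s \<odot> x"
    and "\<And>r x y. \<lbrakk>x \<in> carrier V; y \<in> carrier V\<rbrakk> \<Longrightarrow> r \<odot> (x \<oplus> y) = r \<odot> x \<oplus> r \<odot> y"
    and "\<And>r s x. x \<in> carrier V \<Longrightarrow> (r * s) \<odot> x = r \<odot> (s \<odot> x)"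
    and "\<And>x. x \<in> carrier V \<Longrightarrow> 1 \<odot> x = x"
    and "\<And>x. x \<in> carrier V \<Longrightarrow> vnorm V x = 0 \<longleftrightarrow> x = \<zero>"
    and "\<And>x y. \<lbrakk>x \<in> carrier V; y \<in> carrier V\<rbrakk> \<Longrightarrow> vnorm V (x \<oplus> y) \<le> vnorm V x + vnorm V y"
    and "\<And>r x. x \<in> carrier V \<Longrightarrow> vnorm V (r \<odot> x) = \<bar>r\<bar> * vnorm V x"
  shows "real_normed_space V"
proof -
  interpret module real_ring V
    by (rule moduleI[OF cring_real_ring assms(1)]) (use assms in \<open>auto simp: real_ring_def\<close>)
  show ?thesis
    by unfold_locales (use assms in auto)
qed

lemma real_normed_space_l1: "real_normed_space l1_space"
proof (rule real_normed_spaceI)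
  have add: "summable (\<lambda>n. \<bar>a n + b n\<bar>)"
    if "summable (\<lambda>n. \<bar>a n\<bar>)" "summable (\<lambda>n. \<bar>b n\<bar>)" for a b :: "nat \<Rightarrow> real"
    by (rule summable_comparison_test'[OF summable_add[OF that], of 0]) auto
  have mult: "summable (\<lambda>n. \<bar>r * a n\<bar>)" if "summable (\<lambda>n. \<bar>a n\<bar>)" for r and a :: "nat \<Rightarrow> real"
    using summable_mult[OF that, of "\<bar>r\<bar>"] by (simp add: abs_mult)
  show "abelian_group l1_space"
  proof (rule abelian_groupI)
    show "\<exists>b\<in>carrier l1_space. b \<oplus>\<^bsub>l1_space\<^esub> a = \<zero>\<^bsub>l1_space\<^esub>"
      if "a \<in> carrier l1_space" for a
      using that by (intro bexI[of _ "\<lambda>n. - a n"]) (auto simp: l1_space_def)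
  qed (auto simp: l1_space_def add algebra_simps)
  show "r \<odot>\<^bsub>l1_space\<^esub> a \<in> carrier l1_space" if "a \<in> carrier l1_space" for r a
    using that mult by (simp add: l1_space_def)
  show "vnorm l1_space a = 0 \<longleftrightarrow> a = \<zero>\<^bsub>l1_space\<^esub>" if "a \<in> carrier l1_space" for a
    using that suminf_eq_zero_iff[of "\<lambda>n. \<bar>a n\<bar>"] by (auto simp: l1_space_def fun_eq_iff)
  show "vnorm l1_space (a \<oplus>\<^bsub>l1_space\<^esub> b) \<le> vnorm l1_space a + vnorm l1_space b"
    if "a \<in> carrier l1_space" "b \<in> carrier l1_space" for a b
    using that suminf_le[OF _ add summable_add, of a b "\<lambda>n. \<bar>a n\<bar>" "\<lambda>n. \<bar>b n\<bar>"]
    by (simp add: l1_space_def suminf_add abs_triangle_ineq)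
  show "vnorm l1_space (r \<odot>\<^bsub>l1_space\<^esub> a) = \<bar>r\<bar> * vnorm l1_space a"
    if "a \<in> carrier l1_space" for r a
    using that suminf_mult[of "\<lambda>n. \<bar>a n\<bar>" "\<bar>r\<bar>"] by (simp add: l1_space_def abs_mult)
qed (auto simp: l1_space_def algebra_simps)

context real_normed_space
begin

lemma real_ring_simps [simp]:
  "carrier real_ring = UNIV" "a \<otimes>\<^bsub>real_ring\<^esub> b = a * b" "a \<oplus>\<^bsub>real_ring\<^esub> b = a + b"
  "\<one>\<^bsub>real_ring\<^esub> = 1" "\<zero>\<^bsub>real_ring\<^esub> = 0"
  by (simp_all add: real_ring_def)

lemma smult_in [simp]: "x \<in> carrier V \<Longrightarrow> r \<odot> x \<in> carrier V"
  by (simp add: smult_closed)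

lemma neg_eq: "x \<in> carrier V \<Longrightarrow> \<ominus> x = (- 1) \<odot> x"
proof (rule M.minus_equality)
  assume x: "x \<in> carrier V"
  have "(- 1) \<odot> x \<oplus> 1 \<odot> x = (- 1 + 1) \<odot> x"
    using smult_l_distr[of "-1" 1 x] x by simp
  then show "(- 1) \<odot> x \<oplus> x = \<zero>"
    using smult_one[of x] smult_l_null[of x] x by simp
qed auto

lemma diff_eq: "x \<in> carrier V \<Longrightarrow> y \<in> carrier V \<Longrightarrow> x \<ominus> y = x \<oplus> (- 1) \<odot> y"
  by (simp add: a_minus_def neg_eq)

lemma diff_in [simp]: "x \<in> carrier V \<Longrightarrow> y \<in> carrier V \<Longrightarrow> x \<ominus> y \<in> carrier V"
  by (rule M.minus_closed)

lemma vnorm_zero [simp]: "vnorm V \<zero> = 0"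
  by (simp add: vnorm_eq_0)

lemma vnorm_ge_0: assumes "x \<in> carrier V" shows "0 \<le> vnorm V x"
proof -
  have "vnorm V (x \<oplus> (- 1) \<odot> x) \<le> vnorm V x + vnorm V ((- 1) \<odot> x)"
    using assms by (intro vnorm_triangle) auto
  then show ?thesis
    using assms vnorm_smult[of x "-1"] by (simp add: M.r_neg flip: neg_eq)
qed

lemma diff_eq_zero:
  assumes "x \<in> carrier V" "y \<in> carrier V"
  shows "x \<ominus> y = \<zero> \<longleftrightarrow> x = y"
proof
  assume "x \<ominus> y = \<zero>"
  then have "x \<ominus> y \<oplus> y = y" using assms by simp
  then show "x = y" using assms by (simp add: a_minus_def M.a_assoc M.l_neg)
qed (use assms in \<open>simp add: a_minus_def M.r_neg\<close>)

lemma vdist_eq: "x \<in> carrier V \<Longrightarrow> y \<in> carrier V \<Longrightarrow> vdist V x y = vnorm V (x \<ominus> y)"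
  by (simp add: vdist_def)

lemma diff_add:
  assumes "x \<in> carrier V" "y \<in> carrier V" "x' \<in> carrier V" "y' \<in> carrier V"
  shows "(x \<oplus> y) \<ominus> (x' \<oplus> y') = (x \<ominus> x') \<oplus> (y \<ominus> y')"
  using assms by (simp add: a_minus_def M.minus_add M.a_ac)

lemma diff_smult:
  assumes "x \<in> carrier V" "y \<in> carrier V"
  shows "r \<odot> x \<ominus> r \<odot> y = r \<odot> (x \<ominus> y)"
  using assms smult_assoc1[of r "-1" y] smult_assoc1[of "-1" r y]
  by (simp add: diff_eq smult_r_distr)

sublocale N: Metric_space "carrier V" "vdist V"
proof
  show "0 \<le> vdist V x y" for x y
    by (auto simp: vdist_def vnorm_ge_0)
  have "vnorm V (x \<ominus> y) = vnorm V (y \<ominus> x)" if "x \<in> carrier V" "y \<in> carrier V" for x y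
  proof -
    have "y \<ominus> x = (- 1) \<odot> (x \<ominus> y)"
      using that smult_assoc1[of "-1" "-1" y] smult_one[of y]
      by (simp add: diff_eq smult_r_distr M.a_comm)
    then show ?thesis
      using that by (simp add: vnorm_smult)
  qed
  then show "vdist V x y = vdist V y x" for x y
    by (simp add: vdist_def)
  show "vdist V x y = 0 \<longleftrightarrow> x = y" if "x \<in> carrier V" "y \<in> carrier V" for x y
    using that by (simp add: vdist_def vnorm_eq_0 diff_eq_zero)
  show "vdist V x z \<le> vdist V x y + vdist V y z"
    if "x \<in> carrier V" "y \<in> carrier V" "z \<in> carrier V" for x y z
  proof -
    have "x \<ominus> z = (x \<ominus> y) \<oplus> (y \<ominus> z)"
      using that by (simp add: a_minus_def M.a_assoc M.r_neg1 M.r_neg2 M.l_neg)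
    then show ?thesis
      using that by (simp add: vdist_def vnorm_triangle)
  qed
qed

lemma topspace_norm_topology [simp]: "topspace (norm_topology V) = carrier V"
  by (simp add: norm_topology_def)

lemma subgroup_linear_isometries: "subgroup (linear_isometries V) (BijGroup (carrier V))"
proof -
  interpret B: group "BijGroup (carrier V)"
    by (rule group_BijGroup)
  show ?thesis
  proof (rule B.subgroupI)
    show "linear_isometries V \<subseteq> carrier (BijGroup (carrier V))"
      by (auto simp: linear_isometries_def BijGroup_def)
    have "(\<lambda>x\<in>carrier V. x) \<in> linear_isometries V"
      using id_Bij[of "carrier V"] by (auto simp: linear_isometries_def linear_maps_def)
    then show "linear_isometries V \<noteq> {}"
      by blast
    show "inv\<^bsub>BijGroup (carrier V)\<^esub> S \<in> linear_isometries V" if S: "S \<in> linear_isometries V" for S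
    proof -
      have B: "S \<in> Bij (carrier V)" and L: "S \<in> linear_maps V V"
        and n: "\<And>x. x \<in> carrier V \<Longrightarrow> vnorm V (S x) = vnorm V x"
        using S by (auto simp: linear_isometries_def)
      have inj: "inj_on S (carrier V)" and surj: "S ` carrier V = carrier V"
        using B by (auto simp: Bij_def bij_betw_def)
      define R where "R = inv_into (carrier V) S"
      have R [simp]: "R x \<in> carrier V" "S (R x) = x" if "x \<in> carrier V" for x
        using that surj by (auto simp: R_def inv_into_into f_inv_into_f)
      have RS: "R (S x) = x" if "x \<in> carrier V" for x
        using that inj by (simp add: R_def)
      have "R (x \<oplus> y) = R x \<oplus> R y" if "x \<in> carrier V" "y \<in> carrier V" for x y
      proof -
        have "S (R x \<oplus> R y) = x \<oplus> y"
          using L that by (simp add: linear_maps_def)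
        then show ?thesis
          using RS[of "R x \<oplus> R y"] that by simp
      qed
      moreover have "R (r \<odot> x) = r \<odot> R x" if "x \<in> carrier V" for r x
      proof -
        have "S (r \<odot> R x) = r \<odot> x"
          using L that by (simp add: linear_maps_def)
        then show ?thesis
          using RS[of "r \<odot> R x"] that by simp
      qed
      moreover have "vnorm V (R x) = vnorm V x" if "x \<in> carrier V" for x
        using n[of "R x"] that by simp
      ultimately have "restrict R (carrier V) \<in> linear_isometries V"
        using restrict_inv_into_Bij[OF B]
        by (auto simp: linear_isometries_def linear_maps_def R_def[symmetric])
      then show ?thesis
        by (simp add: inv_BijGroup[OF B] R_def)
    qed
    show "S \<otimes>\<^bsub>BijGroup (carrier V)\<^esub> R \<in> linear_isometries V"
      if "S \<in> linear_isometries V" "R \<in> linear_isometries V" for S R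
      using that compose_Bij[of S "carrier V" R]
      by (auto simp: linear_isometries_def linear_maps_def BijGroup_def compose_def Pi_iff)
  qed
qed

lemma group_iso_group: "group (iso_group V)"
  unfolding iso_group_def
  by (rule group.subgroup_imp_group[OF group_BijGroup subgroup_linear_isometries])

lemma inv_iso_group:
  assumes "S \<in> linear_isometries V" "v \<in> carrier V"
  shows "(inv\<^bsub>iso_group V\<^esub> S) v = inv_into (carrier V) S v"
proof -
  have "S \<in> Bij (carrier V)"
    using assms by (simp add: linear_isometries_def)
  then show ?thesis
    using group.m_inv_consistent[OF group_BijGroup subgroup_linear_isometries assms(1)] assms(2)
    by (simp add: iso_group_def inv_BijGroup)
qed

lemma dual_norm_bound:
  assumes u: "u \<in> dual V" and x: "x \<in> carrier V"
  shows "\<bar>u x\<bar> \<le> dual_norm V u * vnorm V x"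
proof -
  obtain C where C: "\<And>x. x \<in> carrier V \<Longrightarrow> \<bar>u x\<bar> \<le> C * vnorm V x"
    using u unfolding dual_def by blast
  have bdd: "bdd_above ((\<lambda>x. \<bar>u x\<bar>) ` {x \<in> carrier V. vnorm V x \<le> 1})"
  proof (rule bdd_aboveI2)
    fix y assume y: "y \<in> {x \<in> carrier V. vnorm V x \<le> 1}"
    have "C * vnorm V y \<le> \<bar>C\<bar> * vnorm V y"
      using y vnorm_ge_0 by (intro mult_right_mono) auto
    also have "\<dots> \<le> \<bar>C\<bar> * 1"
      using y by (intro mult_left_mono) auto
    finally show "\<bar>u y\<bar> \<le> \<bar>C\<bar>"
      using C[of y] y by simp
  qed
  show ?thesis
  proof (cases "vnorm V x = 0")
    case True
    then show ?thesis using C[OF x] by simp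
  next
    case False
    let ?y = "(1 / vnorm V x) \<odot> x"
    have pos: "vnorm V x > 0"
      using False vnorm_ge_0[OF x] by simp
    have "?y \<in> {x \<in> carrier V. vnorm V x \<le> 1}"
      using x pos by (simp add: vnorm_smult)
    then have "\<bar>u ?y\<bar> \<le> dual_norm V u"
      unfolding dual_norm_def using bdd by (rule cSUP_upper)
    moreover have "\<bar>u ?y\<bar> = \<bar>u x\<bar> / vnorm V x"
      using u x pos by (simp add: dual_def abs_mult)
    ultimately show ?thesis
      using pos by (simp add: divide_simps)
  qed
qed

lemma dual_norm_le:
  assumes "\<And>x. x \<in> carrier V \<Longrightarrow> \<bar>u x\<bar> \<le> C * vnorm V x" "0 \<le> C"
  shows "dual_norm V u \<le> C"
  unfolding dual_norm_def
proof (rule cSUP_least)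
  show "{x \<in> carrier V. vnorm V x \<le> 1} \<noteq> {}"
    by (auto intro!: exI[of _ "\<zero>"])
  show "\<bar>u x\<bar> \<le> C" if "x \<in> {x \<in> carrier V. vnorm V x \<le> 1}" for x
    using assms(1)[of x] mult_left_mono[of "vnorm V x" 1 C] assms(2) that by auto
qed

end

text \<open>
  Transport of structure: a closed linear subspace \<open>E\<close> of a Banach space, recoded on a set
  \<open>U\<close> by a bijection \<open>j\<close>.
\<close>

locale recoded_subspace = real_normed_space V for V :: "'v normed_space" (structure) +
  fixes E :: "'v set" and U :: "'u set" and j :: "'u \<Rightarrow> 'v"
  assumes complete: "N.mcomplete"
    and E_closed: "closedin (norm_topology V) E"
    and E_zero: "\<zero> \<in> E"
    and E_add: "\<lbrakk>x \<in> E; y \<in> E\<rbrakk> \<Longrightarrow> x \<oplus> y \<in> E"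
    and E_smult: "x \<in> E \<Longrightarrow> r \<odot> x \<in> E"
    and bij: "bij_betw j U E"
begin

definition k where "k = inv_into U j"

definition W :: "'u normed_space" where
  "W = \<lparr>carrier = U, mult = undefined, one = undefined, zero = k \<zero>,
     add = (\<lambda>a b. k (j a \<oplus> j b)), smult = (\<lambda>r a. k (r \<odot> j a)), vnorm = (\<lambda>a. vnorm V (j a))\<rparr>"

lemma E_sub: "x \<in> E \<Longrightarrow> x \<in> carrier V"
  using E_closed by (auto simp: closedin_def)

lemma W_carrier [simp]: "carrier W = U"
  by (simp add: W_def)

lemma j_in_E [simp]: "a \<in> U \<Longrightarrow> j a \<in> E"
  using bij by (auto simp: bij_betw_def)

lemma j_in [simp]: "a \<in> U \<Longrightarrow> j a \<in> carrier V"
  by (simp add: E_sub)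

lemma k_in [simp]: "x \<in> E \<Longrightarrow> k x \<in> U"
  unfolding k_def using bij by (metis bij_betw_def inv_into_into)

lemma j_k [simp]: "x \<in> E \<Longrightarrow> j (k x) = x"
  unfolding k_def using bij by (metis bij_betw_inv_into_right)

lemma k_j [simp]: "a \<in> U \<Longrightarrow> k (j a) = a"
  unfolding k_def using bij by (metis bij_betw_inv_into_left)

lemma k_add: "\<lbrakk>x \<in> E; y \<in> E\<rbrakk> \<Longrightarrow> k (x \<oplus> y) = k x \<oplus>\<^bsub>W\<^esub> k y"
  and k_smult: "x \<in> E \<Longrightarrow> k (r \<odot> x) = r \<odot>\<^bsub>W\<^esub> k x"
  by (simp_all add: W_def)

lemma j_inject: "a \<in> U \<Longrightarrow> b \<in> U \<Longrightarrow> j a = j b \<longleftrightarrow> a = b"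
  by (metis k_j)

lemma j_zero [simp]: "j \<zero>\<^bsub>W\<^esub> = \<zero>"
  by (simp add: W_def E_zero)

lemma j_add [simp]: "\<lbrakk>a \<in> U; b \<in> U\<rbrakk> \<Longrightarrow> j (a \<oplus>\<^bsub>W\<^esub> b) = j a \<oplus> j b"
  by (simp add: W_def E_add)

lemma j_smult [simp]: "a \<in> U \<Longrightarrow> j (r \<odot>\<^bsub>W\<^esub> a) = r \<odot> j a"
  by (simp add: W_def E_smult)

lemma vnorm_W: "vnorm W a = vnorm V (j a)"
  by (simp add: W_def)

lemma W_zero_in [simp]: "\<zero>\<^bsub>W\<^esub> \<in> U"
  and W_add_in [simp]: "\<lbrakk>a \<in> U; b \<in> U\<rbrakk> \<Longrightarrow> a \<oplus>\<^bsub>W\<^esub> b \<in> U"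
  and W_smult_in [simp]: "a \<in> U \<Longrightarrow> r \<odot>\<^bsub>W\<^esub> a \<in> U"
  by (simp_all add: W_def E_zero E_add E_smult)

lemma smult_rules:
  assumes "x \<in> carrier V"
  shows "(r + s) \<odot> x = r \<odot> x \<oplus> s \<odot> x" "(r * s) \<odot> x = r \<odot> (s \<odot> x)" "1 \<odot> x = x"
    "y \<in> carrier V \<Longrightarrow> r \<odot> (x \<oplus> y) = r \<odot> x \<oplus> r \<odot> y"
  using assms smult_l_distr[of r s x] smult_r_distr[of r x y] smult_assoc1[of r s x] smult_one[of x]
  by simp_all

lemma real_normed_space_W: "real_normed_space W"
proof (rule real_normed_spaceI)
  show "abelian_group W"
  proof (rule abelian_groupI)
    show "\<exists>b\<in>carrier W. b \<oplus>\<^bsub>W\<^esub> a = \<zero>\<^bsub>W\<^esub>" if a: "a \<in> carrier W" for a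
    proof (rule bexI[of _ "(- 1) \<odot>\<^bsub>W\<^esub> a"])
      have "j ((- 1) \<odot>\<^bsub>W\<^esub> a \<oplus>\<^bsub>W\<^esub> a) = j \<zero>\<^bsub>W\<^esub>"
        using a M.l_neg[of "j a"] by (simp add: neg_eq)
      then show "(- 1) \<odot>\<^bsub>W\<^esub> a \<oplus>\<^bsub>W\<^esub> a = \<zero>\<^bsub>W\<^esub>"
        using a by (subst (asm) j_inject) auto
    qed (use a in simp)
  qed (auto simp: M.a_ac simp flip: j_inject)
qed (auto simp: smult_rules vnorm_W vnorm_eq_0 vnorm_triangle vnorm_smult simp flip: j_inject)

sublocale W: real_normed_space W
  by (rule real_normed_space_W)

sublocale WU: Metric_space U "vdist W"
  using W.N.Metric_space_axioms by simp

lemma vdist_W: "a \<in> U \<Longrightarrow> b \<in> U \<Longrightarrow> vdist W a b = vdist V (j a) (j b)"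
  by (simp add: W.vdist_eq vdist_eq W.diff_eq diff_eq vnorm_W)

lemma banach_space_W: "banach_space W"
proof -
  have "WU.mcomplete"
    unfolding WU.mcomplete_def
  proof (intro allI impI)
    fix \<sigma> assume \<sigma>: "WU.MCauchy \<sigma>"
    then have U: "\<sigma> n \<in> U" for n
      by (auto simp: WU.MCauchy_def)
    have "N.MCauchy (j \<circ> \<sigma>)"
      using \<sigma> U by (auto simp: WU.MCauchy_def N.MCauchy_def vdist_W)
    then obtain l where l: "limitin N.mtopology (j \<circ> \<sigma>) l sequentially"
      using complete by (auto simp: N.mcomplete_def)
    have "l \<in> E"
      using E_closed l U unfolding norm_topology_def N.metric_closedin_iff_sequentially_closed
      by (metis (no_types, lifting) comp_apply image_subset_iff j_in_E)
    then have "limitin WU.mtopology \<sigma> (k l) sequentially"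
      using l U by (simp add: N.limit_metric_sequentially WU.limit_metric_sequentially vdist_W)
    then show "\<exists>x. limitin WU.mtopology \<sigma> x sequentially" ..
  qed
  then show ?thesis
    by (simp add: banach_space_def real_normed_space_W)
qed

lemma rosenthal_space_W:
  assumes "rosenthal_space V"
  shows "rosenthal_space W"
proof -
  have False if "contains_isomorphic_copy W l1_space"
  proof -
    from that obtain S c C where S: "S \<in> linear_maps l1_space W" and c: "c > 0"
      and b: "\<forall>x\<in>carrier l1_space. c * vnorm l1_space x \<le> vnorm W (S x) \<and>
                vnorm W (S x) \<le> C * vnorm l1_space x"
      unfolding contains_isomorphic_copy_def by blast
    have "j \<circ> S \<in> linear_maps l1_space V"
      using S by (auto simp: linear_maps_def Pi_iff)
    then have "contains_isomorphic_copy V l1_space"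
      unfolding contains_isomorphic_copy_def
      using c b by (intro bexI[of _ "j \<circ> S"] exI[of _ c] conjI exI[of _ C]) (auto simp: vnorm_W)
    then show False
      using assms by (simp add: rosenthal_space_def)
  qed
  then show ?thesis
    using banach_space_W by (auto simp: rosenthal_space_def)
qed

lemma continuous_map_to_W:
  assumes f: "continuous_map Z (norm_topology V) (\<lambda>z. j (f z))"
    and U: "\<And>z. z \<in> topspace Z \<Longrightarrow> f z \<in> U"
  shows "continuous_map Z (norm_topology W) f"
  unfolding continuous_map_def
proof (intro conjI allI impI)
  show "f \<in> topspace Z \<rightarrow> topspace (norm_topology W)"
    using U by simp
  fix O' assume O': "openin (norm_topology W) O'"
  show "openin Z {z \<in> topspace Z. f z \<in> O'}"
  proof (subst openin_subopen, intro ballI)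
    fix z assume z: "z \<in> {z \<in> topspace Z. f z \<in> O'}"
    then obtain r where r: "r > 0" "WU.mball (f z) r \<subseteq> O'"
      using O' by (auto simp: norm_topology_def WU.openin_mtopology)
    let ?N = "{y \<in> topspace Z. j (f y) \<in> N.mball (j (f z)) r}"
    have "openin Z ?N"
      by (rule openin_continuous_map_preimage[OF f]) (simp add: norm_topology_def)
    moreover have "z \<in> ?N"
      using z U r by auto
    moreover have "?N \<subseteq> {z \<in> topspace Z. f z \<in> O'}"
      using r U z by (auto simp: vdist_W subset_iff)
    ultimately show "\<exists>T. openin Z T \<and> z \<in> T \<and> T \<subseteq> {z \<in> topspace Z. f z \<in> O'}"
      by blast
  qed
qed

definition restrict_iso where "restrict_iso S = (\<lambda>a\<in>U. k (S (j a)))"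

lemma restrict_iso:
  assumes S: "S \<in> linear_isometries V" and SE: "S ` E = E"
  shows "restrict_iso S \<in> linear_isometries W"
proof -
  have SE': "S x \<in> E" if "x \<in> E" for x
    using SE that by blast
  have inj: "inj_on S (carrier V)"
    using S by (auto simp: linear_isometries_def Bij_def bij_betw_def)
  have "bij_betw (restrict_iso S) U U"
  proof (rule bij_betw_imageI)
    show "inj_on (restrict_iso S) U"
    proof (rule inj_onI)
      fix a b assume "a \<in> U" "b \<in> U" "restrict_iso S a = restrict_iso S b"
      then have "S (j a) = S (j b)"
        by (metis (no_types, lifting) SE' j_in_E j_k restrict_apply' restrict_iso_def)
      then show "a = b"
        using inj \<open>a \<in> U\<close> \<open>b \<in> U\<close> by (auto simp: inj_on_eq_iff j_inject)
    qed
    show "restrict_iso S ` U = U"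
    proof
      show "restrict_iso S ` U \<subseteq> U"
        using SE' by (auto simp: restrict_iso_def)
      show "U \<subseteq> restrict_iso S ` U"
      proof
        fix b assume b: "b \<in> U"
        then obtain x where x: "x \<in> E" "S x = j b"
          using SE j_in_E by (metis imageE)
        then have "restrict_iso S (k x) = b"
          using b by (simp add: restrict_iso_def)
        then show "b \<in> restrict_iso S ` U"
          using x by (metis image_eqI k_in)
      qed
    qed
  qed
  moreover have "restrict_iso S \<in> linear_maps W W"
    using S SE' by (auto simp: linear_isometries_def linear_maps_def restrict_iso_def k_add k_smult)
  ultimately show ?thesis
    using S SE' by (auto simp: linear_isometries_def Bij_def restrict_iso_def vnorm_W)
qed

lemma restrict_dual:
  assumes u: "u \<in> dual V"
  shows "(\<lambda>a\<in>U. u (j a)) \<in> dual W" "dual_norm W (\<lambda>a\<in>U. u (j a)) \<le> \<bar>dual_norm V u\<bar>"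
proof -
  have b: "\<bar>u (j a)\<bar> \<le> \<bar>dual_norm V u\<bar> * vnorm W a" if "a \<in> U" for a
    using dual_norm_bound[OF u, of "j a"] mult_right_mono[OF abs_ge_self[of "dual_norm V u"] vnorm_ge_0[of "j a"]]
      that by (simp add: vnorm_W)
  then show "(\<lambda>a\<in>U. u (j a)) \<in> dual W"
    using u by (auto simp: dual_def)
  show "dual_norm W (\<lambda>a\<in>U. u (j a)) \<le> \<bar>dual_norm V u\<bar>"
    by (rule W.dual_norm_le) (use b in auto)
qed

lemma proper_representation_W:
  assumes G: "G_space G T X \<phi>"
    and rep: "proper_representation G T X \<phi> V h \<alpha>"
    and inv: "\<And>g. g \<in> carrier G \<Longrightarrow> h g ` E = E"
    and sep: "\<And>x O'. openin X O' \<Longrightarrow> x \<in> O' \<Longrightarrow>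
      \<exists>F B. finite F \<and> F \<subseteq> E \<and> (\<forall>v\<in>F. open (B v) \<and> \<alpha> x v \<in> B v) \<and>
        (\<forall>y\<in>topspace X. (\<forall>v\<in>F. \<alpha> y v \<in> B v) \<longrightarrow> y \<in> O')"
  shows "proper_representation G T X \<phi> W (\<lambda>g. restrict_iso (h g)) (\<lambda>x. \<lambda>a\<in>U. \<alpha> x (j a))"
    (is "proper_representation G T X \<phi> W ?h ?\<alpha>")
proof -
  interpret G_space G T X \<phi> by (rule G)
  have h: "h \<in> hom G (iso_group V)" and hc: "continuous_map T (strong_operator_topology V) h"
    and \<alpha>c: "continuous_map X (weak_star_topology V) \<alpha>"
    and bdd: "\<exists>C. \<forall>x\<in>topspace X. dual_norm V (\<alpha> x) \<le> C"
    and equi: "\<And>g x. g \<in> carrier G \<Longrightarrow> x \<in> topspace X \<Longrightarrow> \<alpha> (\<phi> g x) = dual_action V (h g) (\<alpha> x)"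
    using rep by (auto simp: proper_representation_def representation_def)
  have hL: "h g \<in> linear_isometries V" if "g \<in> carrier G" for g
    using h that by (auto simp: hom_def iso_group_def)
  have hE: "h g x \<in> E" if "g \<in> carrier G" "x \<in> E" for g x
    using inv that by blast
  have hL': "?h g \<in> linear_isometries W" if "g \<in> carrier G" for g
    using restrict_iso[OF hL inv] that by simp
  have hB': "?h g \<in> Bij U" if "g \<in> carrier G" for g
    using hL'[OF that] by (simp add: linear_isometries_def)
  have hB: "h g \<in> Bij (carrier V)" if "g \<in> carrier G" for g
    using hL[OF that] by (simp add: linear_isometries_def)
  have \<alpha>d: "\<alpha> x \<in> dual V" if "x \<in> topspace X" for x
    using \<alpha>c that by (auto simp: weak_star_topology_def continuous_map_in_subtopology)
  have \<alpha>d': "?\<alpha> x \<in> dual W" if "x \<in> topspace X" for x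
    using restrict_dual(1)[OF \<alpha>d[OF that]] .

  have "?h \<in> hom G (iso_group W)"
  proof (rule homI)
    show "?h g \<in> carrier (iso_group W)" if "g \<in> carrier G" for g
      using hL'[OF that] by (simp add: iso_group_def)
    fix g g' assume g: "g \<in> carrier G" "g' \<in> carrier G"
    have "h (g \<otimes>\<^bsub>G\<^esub> g') = compose (carrier V) (h g) (h g')"
      using hom_mult[OF h g] hB g by (simp add: iso_group_def BijGroup_def)
    then show "?h (g \<otimes>\<^bsub>G\<^esub> g') = ?h g \<otimes>\<^bsub>iso_group W\<^esub> ?h g'"
      using hB' g hE by (simp add: iso_group_def BijGroup_def restrict_iso_def fun_eq_iff compose_def)
  qed
  moreover have "continuous_map T (strong_operator_topology W) ?h"
  proof -
    have "continuous_map T (norm_topology W) (\<lambda>g. ?h g a)" if a: "a \<in> U" for a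
    proof (rule continuous_map_to_W)
      have "continuous_map T (norm_topology V) (\<lambda>g. h g (j a))"
        using hc a by (auto simp: strong_operator_topology_def continuous_map_in_subtopology
            continuous_map_componentwise)
      then show "continuous_map T (norm_topology V) (\<lambda>g. j (?h g a))"
        by (rule continuous_map_eq) (use a hE topspace_eq_carrier in \<open>auto simp: restrict_iso_def\<close>)
      show "?h g a \<in> U" if "g \<in> topspace T" for g
        using that a hE topspace_eq_carrier by (simp add: restrict_iso_def)
    qed
    then show ?thesis
      using hL' by (auto simp: strong_operator_topology_def continuous_map_in_subtopology
          continuous_map_componentwise topspace_eq_carrier restrict_iso_def)
  qed
  moreover have \<alpha>c': "continuous_map X (weak_star_topology W) ?\<alpha>"
  proof -
    have "continuous_map X euclideanreal (\<lambda>x. \<alpha> x v)" if "v \<in> carrier V" for v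
      using \<alpha>c that by (auto simp: weak_star_topology_def continuous_map_in_subtopology
            continuous_map_componentwise)
    then show ?thesis
      using \<alpha>d' by (auto simp: weak_star_topology_def continuous_map_in_subtopology
            continuous_map_componentwise)
  qed
  moreover have "\<exists>C. \<forall>x\<in>topspace X. dual_norm W (?\<alpha> x) \<le> C"
  proof -
    obtain C where C: "\<And>x. x \<in> topspace X \<Longrightarrow> dual_norm V (\<alpha> x) \<le> C"
      using bdd by blast
    have "dual_norm W (?\<alpha> x) \<le> \<bar>C\<bar>" if x: "x \<in> topspace X" for x
    proof (rule W.dual_norm_le)
      show "\<bar>?\<alpha> x a\<bar> \<le> \<bar>C\<bar> * vnorm W a" if "a \<in> carrier W" for a
      proof -
        have "\<bar>\<alpha> x (j a)\<bar> \<le> dual_norm V (\<alpha> x) * vnorm V (j a)"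
          using that by (intro dual_norm_bound \<alpha>d x) simp
        also have "\<dots> \<le> \<bar>C\<bar> * vnorm V (j a)"
          using C[OF x] that by (intro mult_right_mono vnorm_ge_0) auto
        finally show ?thesis
          using that by (simp add: vnorm_W)
      qed
    qed simp
    then show ?thesis by blast
  qed
  moreover have "?\<alpha> (\<phi> g x) = dual_action W (?h g) (?\<alpha> x)"
    if g: "g \<in> carrier G" and x: "x \<in> topspace X" for g x
  proof
    fix a
    show "?\<alpha> (\<phi> g x) a = dual_action W (?h g) (?\<alpha> x) a"
    proof (cases "a \<in> U")
      case True
      then obtain e where e: "e \<in> E" "h g e = j a"
        using inv[OF g] j_in_E by (metis imageE)
      have injV: "inj_on (h g) (carrier V)" and injW: "inj_on (?h g) U"
        using hB[OF g] hB'[OF g] by (auto simp: Bij_def bij_betw_def)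
      have "inv_into (carrier V) (h g) (j a) = e"
        using inv_into_f_f[OF injV E_sub[OF e(1)]] e by simp
      moreover have "inv_into U (?h g) a = k e"
        using inv_into_f_f[OF injW k_in[OF e(1)]] e True by (simp add: restrict_iso_def)
      ultimately show ?thesis
        using True e equi[OF g x] inv_iso_group[OF hL[OF g], of "j a"] W.inv_iso_group[OF hL'[OF g], of a]
        by (simp add: dual_action_def)
    qed (simp add: dual_action_def)
  qed
  moreover have "embedding_map X (weak_star_topology W) ?\<alpha>"
  proof -
    have inj: "inj_on ?\<alpha> (topspace X)"
    proof (rule inj_onI, rule ccontr)
      fix x y assume xy: "x \<in> topspace X" "y \<in> topspace X" "?\<alpha> x = ?\<alpha> y" "x \<noteq> y"
      then obtain O' where O': "openin X O'" "x \<in> O'" "y \<notin> O'"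
        using tychonoff_X by (metis Hausdorff_space_def disjnt_iff tychonoff_space_def)
      obtain F B where "finite F" "F \<subseteq> E" "\<forall>v\<in>F. open (B v) \<and> \<alpha> x v \<in> B v"
        and *: "\<forall>y\<in>topspace X. (\<forall>v\<in>F. \<alpha> y v \<in> B v) \<longrightarrow> y \<in> O'"
        using sep[OF O'(1,2)] by blast
      moreover have "\<alpha> y v = \<alpha> x v" if "v \<in> E" for v
        using fun_cong[OF xy(3), of "k v"] that by simp
      ultimately have "\<forall>v\<in>F. \<alpha> y v \<in> B v"
        by auto
      then show False
        using * xy O' by blast
    qed
    have "open_map X (subtopology (weak_star_topology W) (?\<alpha> ` topspace X)) ?\<alpha>"
      unfolding open_map_def
    proof (intro allI impI)
      fix O' assume O': "openin X O'"
      show "openin (subtopology (weak_star_topology W) (?\<alpha> ` topspace X)) (?\<alpha> ` O')"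
      proof (subst openin_subopen, intro ballI)
        fix f assume "f \<in> ?\<alpha> ` O'"
        then obtain x where x: "x \<in> O'" "f = ?\<alpha> x" by blast
        have xX: "x \<in> topspace X"
          using O' x openin_subset by blast
        from sep[OF O' x(1)] obtain F B where FB: "finite F \<and> F \<subseteq> E \<and>
            (\<forall>v\<in>F. open (B v) \<and> \<alpha> x v \<in> B v) \<and>
            (\<forall>y\<in>topspace X. (\<forall>v\<in>F. \<alpha> y v \<in> B v) \<longrightarrow> y \<in> O')"
          by (elim exE) (rule that)
        then have F: "finite F" "F \<subseteq> E" and B: "\<And>v. v \<in> F \<Longrightarrow> open (B v) \<and> \<alpha> x v \<in> B v"
          by simp_all
        have *: "y \<in> O'" if "y \<in> topspace X" "\<And>v. v \<in> F \<Longrightarrow> \<alpha> y v \<in> B v" for y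
          using FB that by simp
        define N where "N = (\<Inter>v\<in>F. {u \<in> topspace (weak_star_topology W). u (k v) \<in> B v}) \<inter>
          topspace (weak_star_topology W)"
        have "openin (weak_star_topology W) N"
          unfolding N_def
        proof (rule openin_INT[OF F(1)])
          fix v assume v: "v \<in> F"
          have "continuous_map (weak_star_topology W) euclideanreal (\<lambda>u. u (k v))"
            unfolding weak_star_topology_def
            using v F by (intro continuous_map_from_subtopology continuous_map_product_coordinates) auto
          then show "openin (weak_star_topology W) {u \<in> topspace (weak_star_topology W). u (k v) \<in> B v}"
            by (rule openin_continuous_map_preimage) (use B v in simp)
        qed
        then have "openin (subtopology (weak_star_topology W) (?\<alpha> ` topspace X)) (?\<alpha> ` topspace X \<inter> N)"
          by (rule openin_subtopology_Int2)
        moreover have "f \<in> ?\<alpha> ` topspace X \<inter> N"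
        proof -
          have "?\<alpha> x \<in> topspace (weak_star_topology W)"
            using continuous_map_image_subset_topspace[OF \<alpha>c'] xX by blast
          moreover have "?\<alpha> x (k v) \<in> B v" if "v \<in> F" for v
            using that B[OF that] F(2) by (simp add: subset_iff)
          ultimately have "?\<alpha> x \<in> N"
            unfolding N_def by blast
          then show ?thesis
            using x xX by blast
        qed
        moreover have "?\<alpha> ` topspace X \<inter> N \<subseteq> ?\<alpha> ` O'"
        proof
          fix u assume u: "u \<in> ?\<alpha> ` topspace X \<inter> N"
          then obtain y where y: "y \<in> topspace X" "u = ?\<alpha> y" by blast
          have "\<alpha> y v \<in> B v" if "v \<in> F" for v
          proof -
            have "u (k v) \<in> B v"
              using u that by (auto simp: N_def)
            then show ?thesis
              using that F y by (auto simp: subset_iff)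
          qed
          then show "u \<in> ?\<alpha> ` O'"
            unfolding y(2) by (intro imageI *[OF y(1)])
        qed
        ultimately show "\<exists>N. openin (subtopology (weak_star_topology W) (?\<alpha> ` topspace X)) N \<and> f \<in> N \<and> N \<subseteq> ?\<alpha> ` O'"
          by blast
      qed
    qed
    moreover have "continuous_map X (subtopology (weak_star_topology W) (?\<alpha> ` topspace X)) ?\<alpha>"
      using \<alpha>c' by (simp add: continuous_map_in_subtopology)
    moreover have "?\<alpha> ` topspace X = topspace (subtopology (weak_star_topology W) (?\<alpha> ` topspace X))"
      using continuous_map_image_subset_topspace[OF \<alpha>c'] by auto
    ultimately show ?thesis
      unfolding embedding_map_def using inj by (intro bijective_open_imp_homeomorphic_map) auto
  qed
  ultimately show ?thesis
    by (auto simp: proper_representation_def representation_def)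
qed

end

theorem rosenthal_representableI:
  fixes V :: "'v normed_space" and G (structure) and T :: "'g topology" and X :: "'x topology"
  assumes G: "G_space G T X \<phi>" and ros: "rosenthal_space V"
    and rep: "proper_representation G T X \<phi> V h \<alpha>"
  shows "rosenthal_representable G T X \<phi>"
proof -
  interpret G_space G T X \<phi> by (rule G)
  interpret V: real_normed_space V
    using ros by (simp add: rosenthal_space_def banach_space_def)
  have h: "h \<in> hom G (iso_group V)" and \<alpha>e: "embedding_map X (weak_star_topology V) \<alpha>"
    and \<alpha>c: "continuous_map X (weak_star_topology V) \<alpha>"
    using rep by (auto simp: proper_representation_def representation_def)
  have hL: "h g \<in> linear_isometries V" if "g \<in> carrier G" for g
    using h that by (auto simp: hom_def iso_group_def)
  have hB: "h g \<in> Bij (carrier V)" if "g \<in> carrier G" for g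
    using hL[OF that] by (simp add: linear_isometries_def)
  have hV [simp]: "h g v \<in> carrier V" if "g \<in> carrier G" "v \<in> carrier V" for g v
    using hB[OF that(1)] that(2) by (auto dest: Bij_imp_funcset)
  have h_add: "h g (v \<oplus>\<^bsub>V\<^esub> w) = h g v \<oplus>\<^bsub>V\<^esub> h g w"
    if "g \<in> carrier G" "v \<in> carrier V" "w \<in> carrier V" for g v w
    using hL[OF that(1)] that by (auto simp: linear_isometries_def linear_maps_def)
  have h_smult: "h g (r \<odot>\<^bsub>V\<^esub> v) = r \<odot>\<^bsub>V\<^esub> h g v" if "g \<in> carrier G" "v \<in> carrier V" for g r v
    using hL[OF that(1)] that by (auto simp: linear_isometries_def linear_maps_def)
  have h_zero: "h g \<zero>\<^bsub>V\<^esub> = \<zero>\<^bsub>V\<^esub>" if "g \<in> carrier G" for g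
    using h_smult[OF that, of "\<zero>\<^bsub>V\<^esub>" 0] that
      V.smult_l_null[of "\<zero>\<^bsub>V\<^esub>"] V.smult_l_null[of "h g \<zero>\<^bsub>V\<^esub>"] by simp
  have h_norm: "vnorm V (h g v) = vnorm V v" if "g \<in> carrier G" "v \<in> carrier V" for g v
    using hL[OF that(1)] that by (auto simp: linear_isometries_def)
  have h_mult: "h (g \<otimes> g') v = h g (h g' v)"
    if "g \<in> carrier G" "g' \<in> carrier G" "v \<in> carrier V" for g g' v
    using hom_mult[OF h that(1,2)] hB that by (simp add: iso_group_def BijGroup_def compose_def)
  have h_one: "h \<one> v = v" if v: "v \<in> carrier V" for v
  proof -
    have "h \<one> (h \<one> v) = h \<one> v"
      using h_mult[of \<one> \<one> v] v by simp
    moreover have "inj_on (h \<one>) (carrier V)"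
      using hB[of \<one>] by (simp add: Bij_def bij_betw_def)
    ultimately show ?thesis
      using v by (simp add: inj_on_eq_iff)
  qed
  have h_dist: "vdist V (h g v) (h g w) = vdist V v w"
    if "g \<in> carrier G" "v \<in> carrier V" "w \<in> carrier V" for g v w
    using that h_norm[of g "v \<ominus>\<^bsub>V\<^esub> w"]
    by (simp add: V.vdist_eq V.diff_eq h_add h_smult)

  have sep: "\<exists>F B. finite F \<and> F \<subseteq> carrier V \<and> (\<forall>v\<in>F. open (B v) \<and> \<alpha> x v \<in> B v) \<and>
      (\<forall>y\<in>topspace X. (\<forall>v\<in>F. \<alpha> y v \<in> B v) \<longrightarrow> y \<in> O')"
    if O': "openin X O'" "x \<in> O'" for x O'
  proof -
    have inj: "inj_on \<alpha> (topspace X)"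
      using \<alpha>e by (simp add: embedding_map_def homeomorphic_eq_everything_map)
    have "openin (subtopology (weak_star_topology V) (\<alpha> ` topspace X)) (\<alpha> ` O')"
      using homeomorphic_imp_open_map[OF \<alpha>e[unfolded embedding_map_def]] O'(1)
      unfolding open_map_def by blast
    then obtain Q where Q: "openin (powertop_real (carrier V)) Q"
      and QO: "\<alpha> ` O' = Q \<inter> dual V \<inter> \<alpha> ` topspace X"
      by (auto simp: weak_star_topology_def openin_subtopology)
    have "\<alpha> x \<in> Q"
      using QO O' by blast
    with Q have "\<exists>B. finite {v \<in> carrier V. B v \<noteq> topspace euclideanreal} \<and>
        (\<forall>v\<in>carrier V. openin euclideanreal (B v)) \<and>
        \<alpha> x \<in> Pi\<^sub>E (carrier V) B \<and> Pi\<^sub>E (carrier V) B \<subseteq> Q"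
      unfolding openin_product_topology_alt by (rule bspec)
    then obtain B where "finite {v \<in> carrier V. B v \<noteq> topspace euclideanreal} \<and>
        (\<forall>v\<in>carrier V. openin euclideanreal (B v)) \<and>
        \<alpha> x \<in> Pi\<^sub>E (carrier V) B \<and> Pi\<^sub>E (carrier V) B \<subseteq> Q"
      by (elim exE) (rule that)
    then have B: "finite {v \<in> carrier V. B v \<noteq> UNIV}" "\<And>v. v \<in> carrier V \<Longrightarrow> open (B v)"
      "\<alpha> x \<in> Pi\<^sub>E (carrier V) B" "Pi\<^sub>E (carrier V) B \<subseteq> Q"
      by (simp_all flip: open_openin)
    have "y \<in> O'" if y: "y \<in> topspace X" "\<forall>v\<in>{v \<in> carrier V. B v \<noteq> UNIV}. \<alpha> y v \<in> B v" for y
    proof -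
      have d: "\<alpha> y \<in> dual V"
        using \<alpha>c y(1) by (auto simp: weak_star_topology_def continuous_map_in_subtopology)
      then have "\<alpha> y \<in> Pi\<^sub>E (carrier V) B"
        using y(2) by (auto simp: dual_def PiE_def)
      then have "\<alpha> y \<in> \<alpha> ` O'"
        using B(4) QO d y(1) by blast
      then show ?thesis
        using inj_on_image_mem_iff[OF inj y(1) openin_subset[OF O'(1)]] by simp
    qed
    moreover have "open (B v) \<and> \<alpha> x v \<in> B v" if "v \<in> {v \<in> carrier V. B v \<noteq> UNIV}" for v
      using that B(2) PiE_mem[OF B(3)] by simp
    ultimately show ?thesis
      using B(1) by (intro exI[of _ "{v \<in> carrier V. B v \<noteq> UNIV}"] exI[of _ B] conjI ballI impI) auto
  qed

  define P where "P x O' F \<longleftrightarrow> finite F \<and> F \<subseteq> carrier V \<and> F \<noteq> {} \<and>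
      (\<exists>B. (\<forall>v\<in>F. open (B v) \<and> \<alpha> x v \<in> B v) \<and>
      (\<forall>y\<in>topspace X. (\<forall>v\<in>F. \<alpha> y v \<in> B v) \<longrightarrow> y \<in> O'))" for x O' F
  have "\<exists>w :: nat \<Rightarrow> 'v. range w \<subseteq> carrier V \<and> (openin X O' \<and> x \<in> O' \<longrightarrow> P x O' (range w))" for x O'
  proof (cases "openin X O' \<and> x \<in> O'")
    case True
    from sep[OF conjunct1[OF True] conjunct2[OF True]] obtain F B where
      FB: "finite F \<and> F \<subseteq> carrier V \<and> (\<forall>v\<in>F. open (B v) \<and> \<alpha> x v \<in> B v) \<and>
        (\<forall>y\<in>topspace X. (\<forall>v\<in>F. \<alpha> y v \<in> B v) \<longrightarrow> y \<in> O')"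
      by (elim exE) (rule that)
    then have F: "finite F" "F \<subseteq> carrier V"
      by simp_all
    define B' where "B' v = (if v \<in> F then B v else UNIV)" for v
    have "\<forall>v\<in>insert \<zero>\<^bsub>V\<^esub> F. open (B' v) \<and> \<alpha> x v \<in> B' v"
      using FB by (simp add: B'_def)
    moreover have "y \<in> O'" if "y \<in> topspace X" "\<forall>v\<in>insert \<zero>\<^bsub>V\<^esub> F. \<alpha> y v \<in> B' v" for y
    proof -
      have "\<forall>v\<in>F. \<alpha> y v \<in> B v"
        using that(2) by (simp add: B'_def)
      then show ?thesis
        using FB that(1) by simp
    qed
    ultimately have "P x O' (insert \<zero>\<^bsub>V\<^esub> F)"
      unfolding P_def using F by (intro conjI exI[of _ B']) simp_all
    then show ?thesis
      using F(1,2) range_from_nat_into[of "insert \<zero>\<^bsub>V\<^esub> F"]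
      by (intro exI[of _ "from_nat_into (insert \<zero>\<^bsub>V\<^esub> F)"]) (simp add: countable_finite)
  next
    case False
    then show ?thesis
      by (intro exI[of _ "\<lambda>_. \<zero>\<^bsub>V\<^esub>"]) auto
  qed
  then have "\<exists>w :: 'x \<Rightarrow> 'x set \<Rightarrow> nat \<Rightarrow> 'v. \<forall>x O'. range (w x O') \<subseteq> carrier V \<and>
      (openin X O' \<and> x \<in> O' \<longrightarrow> P x O' (range (w x O')))"
    by (intro choice allI)
  then obtain w :: "'x \<Rightarrow> 'x set \<Rightarrow> nat \<Rightarrow> 'v" where "\<forall>x O'. range (w x O') \<subseteq> carrier V \<and>
      (openin X O' \<and> x \<in> O' \<longrightarrow> P x O' (range (w x O')))" ..
  then have w: "w x O' n \<in> carrier V"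
    and wP: "openin X O' \<Longrightarrow> x \<in> O' \<Longrightarrow> P x O' (range (w x O'))" for x O' n
    by (simp_all add: image_subset_iff)

  define s where "s = (\<lambda>(g, x, O', n). if g \<in> carrier G then h g (w x O' n) else \<zero>\<^bsub>V\<^esub>)"
  define comb :: "(real \<times> 'g \<times> 'x \<times> 'x set \<times> nat) list \<Rightarrow> 'v" where
    "comb l = foldr (\<lambda>(r, i) v. r \<odot>\<^bsub>V\<^esub> s i \<oplus>\<^bsub>V\<^esub> v) l \<zero>\<^bsub>V\<^esub>" for l
  have s_in [simp]: "s i \<in> carrier V" for i
    using w by (auto simp: s_def split: prod.splits)
  have comb_simps [simp]: "comb [] = \<zero>\<^bsub>V\<^esub>" "comb ((r, i) # l) = r \<odot>\<^bsub>V\<^esub> s i \<oplus>\<^bsub>V\<^esub> comb l" for r i l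
    by (simp_all add: comb_def)
  have comb_in [simp]: "comb l \<in> carrier V" for l
    by (induction l) auto
  have comb_append: "comb (l @ m) = comb l \<oplus>\<^bsub>V\<^esub> comb m" for l m
    by (induction l) (auto simp: V.M.a_assoc)
  have comb_smult: "comb (map (\<lambda>(q, i). (r * q, i)) l) = r \<odot>\<^bsub>V\<^esub> comb l" for r l
  proof (induction l)
    case (Cons a l)
    then show ?case
      using V.smult_assoc1[of r "fst a" "s (snd a)"]
      by (cases a) (simp add: V.smult_r_distr)
  qed simp
  have comb_act: "\<exists>m. h g (comb l) = comb m" if g: "g \<in> carrier G" for g l
  proof (induction l)
    case Nil
    show ?case
      using h_zero[OF g] by (intro exI[of _ "[]"]) simp
  next
    case (Cons a l)
    then obtain m where m: "h g (comb l) = comb m" by blast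
    obtain r k x O' n where a: "a = (r, k, x, O', n)" by (cases a)
    have "h g (s (k, x, O', n)) = s (if k \<in> carrier G then g \<otimes> k else k, x, O', n)"
      using g w h_zero[OF g] by (auto simp: s_def h_mult)
    then show ?case
      using g m
      by (intro exI[of _ "(r, if k \<in> carrier G then g \<otimes> k else k, x, O', n) # m"])
         (simp add: a h_add h_smult)
  qed

  define E where "E = norm_topology V closure_of range comb"
  have E_iff: "v \<in> E \<longleftrightarrow> v \<in> carrier V \<and> (\<forall>r>0. \<exists>l. vdist V v (comb l) < r)" for v
    unfolding E_def norm_topology_def V.N.metric_closure_of by auto
  have comb_E: "comb l \<in> E" for l
    unfolding E_iff using V.N.zero[of "comb l" "comb l"] by (metis comb_in)

  define Q where "Q v c \<longleftrightarrow> (\<forall>n. vdist V v (comb (c n)) < 1 / Suc n)" for v and c :: "('g, 'x) universe"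
  define enc where "enc v = (SOME c. Q v c)" for v
  have enc: "Q v (enc v)" if "v \<in> E" for v
  proof -
    have "\<forall>n. \<exists>l. vdist V v (comb l) < 1 / Suc n"
      using that by (simp add: E_iff)
    then have "\<exists>c. Q v c"
      unfolding Q_def by (rule choice)
    then show ?thesis
      unfolding enc_def by (rule someI_ex)
  qed
  have "inj_on enc E"
  proof (rule inj_onI, rule ccontr)
    fix v v' assume v: "v \<in> E" "v' \<in> E" "enc v = enc v'" "v \<noteq> v'"
    have V: "v \<in> carrier V" "v' \<in> carrier V"
      using v by (auto simp: E_iff)
    then have "vdist V v v' > 0"
      using v V.N.zero[of v v'] V.N.nonneg[of v v'] by linarith
    then obtain n where n: "1 / Suc n < vdist V v v' / 2"
      by (meson half_gt_zero nat_approx_posE)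
    have "vdist V v v' \<le> vdist V v (comb (enc v n)) + vdist V (comb (enc v n)) v'"
      using V by (intro V.N.triangle) auto
    moreover have "vdist V v (comb (enc v n)) < 1 / Suc n" "vdist V v' (comb (enc v n)) < 1 / Suc n"
      using enc[OF v(1)] enc[OF v(2)] v(3) by (auto simp: Q_def)
    ultimately show False
      using n V.N.commute[of v' "comb (enc v n)"] by linarith
  qed
  then have bij: "bij_betw (inv_into E enc) (enc ` E) E"
    by (simp add: bij_betw_inv_into inj_on_imp_bij_betw)

  interpret R: recoded_subspace V E "enc ` E" "inv_into E enc"
  proof
    show "V.N.mcomplete"
      using ros by (simp add: rosenthal_space_def banach_space_def)
    show "closedin (norm_topology V) E"
      by (simp add: E_def)
    show "\<zero>\<^bsub>V\<^esub> \<in> E"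
      using comb_E[of "[]"] by simp
    show "x \<oplus>\<^bsub>V\<^esub> y \<in> E" if xy: "x \<in> E" "y \<in> E" for x y
      unfolding E_iff
    proof (intro conjI allI impI)
      show "x \<oplus>\<^bsub>V\<^esub> y \<in> carrier V"
        using xy by (simp add: E_iff)
      fix r :: real assume "r > 0"
      then obtain l m where lm: "vdist V x (comb l) < r / 2" "vdist V y (comb m) < r / 2"
        using xy unfolding E_iff by (meson half_gt_zero)
      have "vdist V (x \<oplus>\<^bsub>V\<^esub> y) (comb (l @ m)) \<le> vdist V x (comb l) + vdist V y (comb m)"
        using xy by (simp add: E_iff V.vdist_eq comb_append V.diff_add V.vnorm_triangle)
      then show "\<exists>l. vdist V (x \<oplus>\<^bsub>V\<^esub> y) (comb l) < r"
        using lm by (intro exI[of _ "l @ m"]) linarith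
    qed
    show "q \<odot>\<^bsub>V\<^esub> x \<in> E" if x: "x \<in> E" for x q
      unfolding E_iff
    proof (intro conjI allI impI)
      show "q \<odot>\<^bsub>V\<^esub> x \<in> carrier V"
        using x by (simp add: E_iff)
      fix r :: real assume r: "r > 0"
      then obtain l where l: "vdist V x (comb l) < r / (\<bar>q\<bar> + 1)"
        using x unfolding E_iff by (meson abs_ge_zero add_nonneg_pos divide_pos_pos zero_less_one)
      have "vdist V (q \<odot>\<^bsub>V\<^esub> x) (comb (map (\<lambda>(p, i). (q * p, i)) l)) = \<bar>q\<bar> * vdist V x (comb l)"
        using x by (simp add: E_iff V.vdist_eq comb_smult V.diff_smult V.vnorm_smult)
      also have "\<dots> \<le> (\<bar>q\<bar> + 1) * vdist V x (comb l)"
        by (intro mult_right_mono) auto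
      also have "\<dots> < r"
        using l by (simp add: field_simps)
      finally show "\<exists>l. vdist V (q \<odot>\<^bsub>V\<^esub> x) (comb l) < r" ..
    qed
  qed (rule bij)

  have inv_sub: "h g v \<in> E" if g: "g \<in> carrier G" and v: "v \<in> E" for g v
    unfolding E_iff
  proof (intro conjI allI impI)
    show "h g v \<in> carrier V"
      using g v by (simp add: E_iff)
    fix r :: real assume "r > 0"
    then obtain l where l: "vdist V v (comb l) < r"
      using v E_iff by blast
    obtain m where "h g (comb l) = comb m"
      using comb_act[OF g] by blast
    then have "vdist V (h g v) (comb m) < r"
      using l g v h_dist[of g v "comb l"] by (simp add: E_iff)
    then show "\<exists>l. vdist V (h g v) (comb l) < r" ..
  qed
  have inv: "h g ` E = E" if g: "g \<in> carrier G" for g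
  proof
    show "h g ` E \<subseteq> E"
      using inv_sub g by blast
    show "E \<subseteq> h g ` E"
    proof
      fix v assume v: "v \<in> E"
      then have "h g (h (inv g) v) = v"
        using g h_mult[of g "inv g" v] h_one[of v] by (simp add: E_iff)
      then show "v \<in> h g ` E"
        using inv_sub[of "inv g" v] g v by (metis image_eqI inv_closed)
    qed
  qed

  have w_E: "w x O' n \<in> E" for x O' n
  proof -
    have "comb [(1, \<one>, x, O', n)] = w x O' n"
      using V.smult_one[of "w x O' n"] w by (simp add: s_def h_one)
    then show ?thesis
      by (metis comb_E)
  qed

  have "proper_representation G T X \<phi> R.W (\<lambda>g. R.restrict_iso (h g))
      (\<lambda>x. \<lambda>a\<in>enc ` E. \<alpha> x (inv_into E enc a))"
  proof (rule R.proper_representation_W[OF G rep inv])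
    fix x O' assume O': "openin X O'" "x \<in> O'"
    show "\<exists>F B. finite F \<and> F \<subseteq> E \<and> (\<forall>v\<in>F. open (B v) \<and> \<alpha> x v \<in> B v) \<and>
        (\<forall>y\<in>topspace X. (\<forall>v\<in>F. \<alpha> y v \<in> B v) \<longrightarrow> y \<in> O')"
    proof -
      have fin: "finite (range (w x O'))" and sub: "range (w x O') \<subseteq> E"
        using wP[OF O'] w_E by (auto simp: P_def)
      have "\<exists>B. (\<forall>v\<in>range (w x O'). open (B v) \<and> \<alpha> x v \<in> B v) \<and>
          (\<forall>y\<in>topspace X. (\<forall>v\<in>range (w x O'). \<alpha> y v \<in> B v) \<longrightarrow> y \<in> O')"
        using wP[OF O'] unfolding P_def by (elim conjE)
      with fin sub show ?thesis
        by (elim exE) (intro exI conjI; (assumption | elim conjE))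
    qed
  qed
  then show ?thesis
    unfolding rosenthal_representable_def using R.rosenthal_space_W[OF ros] by blast
qed

end

theory Submission
  imports Defs
begin

text \<open>
  The group is a semidirect product of the compact group of all configurations of countably many
  two-state lamps with a countable discrete group \<open>H\<close> that permutes the lamps simply transitively.
  Conjugation by \<open>H\<close> acts on the configurations as a Bernoulli shift. If \<open>\<alpha>\<close> embeds the group into
  the dual of \<open>V\<close>, some \<open>v\<close> separates the images of the configurations with all lamps off and all
  lamps on. By continuity the value \<open>\<alpha> x v\<close> near these two points is controlled by finitely many
  lamps. Translating this finite set to pairwise disjoint blocks, and using that the lamps in
  distinct blocks are independent, one finds in the orbit of \<open>v\<close> a bounded sequence that is
  equivalent to the unit vector basis of \<open>l\<^sub>1\<close>.
\<close>

unbundle bit_operations_syntax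

section \<open>Copies of the space of summable sequences\<close>

context real_normed_space
begin

lemma vnorm_le_vdist:
  assumes "x \<in> carrier V" "y \<in> carrier V"
  shows "vnorm V x \<le> vnorm V y + vdist V x y"
proof -
  have "x = y \<oplus> (x \<ominus> y)"
    using assms by (simp add: a_minus_def M.a_lcomm M.r_neg)
  then have "vnorm V x \<le> vnorm V y + vnorm V (x \<ominus> y)"
    using vnorm_triangle[of y "x \<ominus> y"] assms by simp
  then show ?thesis
    using assms by (simp add: vdist_eq)
qed

lemma vdist_add_right:
  assumes "x \<in> carrier V" "y \<in> carrier V"
  shows "vdist V x (x \<oplus> y) = vnorm V y"
proof -
  have "(x \<oplus> y) \<ominus> x = y \<oplus> (x \<oplus> \<ominus> x)"
    using assms by (simp add: a_minus_def M.a_ac)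
  then have "(x \<oplus> y) \<ominus> x = y"
    using assms by (simp add: M.r_neg)
  then show ?thesis
    using assms by (subst N.commute) (simp add: vdist_eq)
qed

lemma vdist_add:
  assumes "x \<in> carrier V" "y \<in> carrier V" "x' \<in> carrier V" "y' \<in> carrier V"
  shows "vdist V (x \<oplus> y) (x' \<oplus> y') \<le> vdist V x x' + vdist V y y'"
  using assms by (simp add: vdist_eq diff_add vnorm_triangle)

lemma vdist_smult:
  assumes "x \<in> carrier V" "y \<in> carrier V"
  shows "vdist V (r \<odot> x) (r \<odot> y) = \<bar>r\<bar> * vdist V x y"
  using assms by (simp add: vdist_eq diff_smult vnorm_smult)

lemma limitin_norm_iff:
  assumes "\<And>n :: nat. x n \<in> carrier V"
  shows "limitin N.mtopology x l sequentially \<longleftrightarrow>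
    l \<in> carrier V \<and> (\<lambda>n. vdist V (x n) l) \<longlonglongrightarrow> 0"
  using assms by (simp add: N.limitin_metric_dist_null)

text \<open>The embedding sends a summable \<open>a\<close> to the sum of the series with terms
  \<open>a k\<close> times \<open>w k\<close>. The bound \<open>B\<close> makes the partial sums
  Cauchy, completeness supplies the limit, and both norm estimates pass from partial sums to
  limits.\<close>

lemma contains_l1_if_lower_estimate:
  fixes w :: "nat \<Rightarrow> 'v"
  assumes complete: "N.mcomplete"
    and w: "\<And>n. w n \<in> carrier V" and B: "\<And>n. vnorm V (w n) \<le> B" and c: "c > 0"
    and lower: "\<And>a n. c * (\<Sum>k<n. \<bar>a k\<bar>) \<le> vnorm V (\<Oplus>k\<in>{..<n}. a k \<odot> w k)"
  shows "contains_isomorphic_copy V l1_space"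
proof -
  define p where "p a n = (\<Oplus>k\<in>{..<n}. a k \<odot> w k)" for a :: "nat \<Rightarrow> real" and n :: nat
  have p_0: "p a 0 = \<zero>" for a
    by (simp add: p_def)
  have p_Suc: "p a (Suc n) = p a n \<oplus> a n \<odot> w n" for a n
    unfolding p_def lessThan_Suc using w
    by (subst M.finsum_insert) (auto simp: M.a_comm Pi_iff)
  have p_in [simp]: "p a n \<in> carrier V" for a n
    unfolding p_def using w by (intro M.finsum_closed) auto
  have p_add: "p (\<lambda>k. a k + b k) n = p a n \<oplus> p b n" for a b n
  proof (induction n)
    case (Suc n)
    have "(a n + b n) \<odot> w n = a n \<odot> w n \<oplus> b n \<odot> w n"
      using smult_l_distr[of "a n" "b n" "w n"] w by simp
    then show ?case
      using w by (simp add: p_Suc Suc M.a_ac)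
  qed (simp add: p_0)
  have p_smult: "p (\<lambda>k. r * a k) n = r \<odot> p a n" for r a n
  proof (induction n)
    case (Suc n)
    have "(r * a n) \<odot> w n = r \<odot> (a n \<odot> w n)"
      using smult_assoc1[of r "a n" "w n"] w by simp
    then show ?case
      using w by (simp add: p_Suc Suc smult_r_distr)
  qed (simp add: p_0)
  \<comment> \<open>This tail bound serves twice: for large \<open>m\<close> it gives the Cauchy
    property, and for \<open>m = 0\<close> the upper norm estimate.\<close>
  have p_dist: "vdist V (p a m) (p a n) \<le> B * (\<Sum>k=m..<n. \<bar>a k\<bar>)" if "m \<le> n" for a m n
    using that
  proof (induction n rule: dec_induct)
    case (step n)
    have "vdist V (p a m) (p a (Suc n)) \<le> vdist V (p a m) (p a n) + vdist V (p a n) (p a (Suc n))"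
      by (rule N.triangle) auto
    also have "vdist V (p a n) (p a (Suc n)) = \<bar>a n\<bar> * vnorm V (w n)"
      using w by (simp add: p_Suc vdist_add_right vnorm_smult)
    also have "\<dots> \<le> B * \<bar>a n\<bar>"
      using mult_left_mono[OF B[of n], of "\<bar>a n\<bar>"] by (simp add: mult.commute)
    finally show ?case
      using step by (simp add: algebra_simps)
  qed (simp add: N.mdist_zero)
  have B0: "0 \<le> B"
    using B[of 0] vnorm_ge_0[OF w[of 0]] by linarith

  have "\<exists>l. limitin N.mtopology (p a) l sequentially" if a: "summable (\<lambda>k. \<bar>a k\<bar>)" for a
  proof -
    have "N.MCauchy (p a)"
      unfolding N.MCauchy_def
    proof (intro conjI allI impI)
      fix e :: real assume e: "e > 0"
      \<comment> \<open>The divisor is \<open>B + 1\<close> because \<open>B\<close> may be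
        0.\<close>
      obtain K where K: "\<And>m n. m \<ge> K \<Longrightarrow> norm (\<Sum>k=m..<n. \<bar>a k\<bar>) < e / (B + 1)"
        using a e B0 unfolding summable_Cauchy by (metis add_nonneg_pos divide_pos_pos zero_less_one)
      have *: "vdist V (p a m) (p a n) < e" if "K \<le> m" "m \<le> n" for m n
      proof -
        have "vdist V (p a m) (p a n) \<le> B * (\<Sum>k=m..<n. \<bar>a k\<bar>)"
          by (rule p_dist[OF that(2)])
        also have "\<dots> \<le> (B + 1) * (\<Sum>k=m..<n. \<bar>a k\<bar>)"
          by (intro mult_right_mono sum_nonneg) auto
        also have "\<dots> < e"
          using K[OF that(1), of n] B0 by (simp add: field_simps)
        finally show ?thesis .
      qed
      then have "vdist V (p a m) (p a n) < e" if "K \<le> m" "K \<le> n" for m n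
        using that N.commute by (metis nle_le)
      then show "\<exists>K. \<forall>n n'. K \<le> n \<longrightarrow> K \<le> n' \<longrightarrow> vdist V (p a n) (p a n') < e"
        by blast
    qed auto
    then show ?thesis
      using complete by (simp add: N.mcomplete_def)
  qed
  \<comment> \<open>\<open>S\<close> is determined on summable sequences only; elsewhere its values
    are arbitrary.\<close>
  then obtain S where S: "\<And>a. summable (\<lambda>k. \<bar>a k\<bar>) \<Longrightarrow> limitin N.mtopology (p a) (S a) sequentially"
    by metis
  have l1: "a \<in> carrier l1_space \<longleftrightarrow> summable (\<lambda>k. \<bar>a k\<bar>)" for a
    by (simp add: l1_space_def)
  have S_in [simp]: "S a \<in> carrier V" and S_lim: "(\<lambda>n. vdist V (p a n) (S a)) \<longlonglongrightarrow> 0"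
    if "a \<in> carrier l1_space" for a
    using S[of a] that by (simp_all add: l1 limitin_norm_iff)
  \<comment> \<open>Uniqueness of limits reduces linearity of \<open>S\<close> to convergence of the
    partial sums to the expected value.\<close>
  have S_eq: "S a = l"
    if "a \<in> carrier l1_space" "l \<in> carrier V" "(\<lambda>n. vdist V (p a n) l) \<longlonglongrightarrow> 0" for a l
    using S[of a] that by (intro N.limitin_metric_unique[of "p a" _ sequentially])
      (simp_all add: l1 limitin_norm_iff)
  interpret L: real_normed_space l1_space
    by (rule real_normed_space_l1)

  have "S \<in> linear_maps l1_space V"
    unfolding linear_maps_def
  proof (intro CollectI conjI ballI allI)
    show "S \<in> carrier l1_space \<rightarrow> carrier V"
      by simp
    show "S (a \<oplus>\<^bsub>l1_space\<^esub> b) = S a \<oplus> S b"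
      if ab: "a \<in> carrier l1_space" "b \<in> carrier l1_space" for a b
    proof (rule S_eq)
      have "vdist V (p (a \<oplus>\<^bsub>l1_space\<^esub> b) n) (S a \<oplus> S b) \<le>
          vdist V (p a n) (S a) + vdist V (p b n) (S b)" for n
        using ab vdist_add[of "p a n" "p b n" "S a" "S b"] by (simp add: l1_space_def p_add)
      then have "\<forall>\<^sub>F n in sequentially. norm (vdist V (p (a \<oplus>\<^bsub>l1_space\<^esub> b) n) (S a \<oplus> S b)) \<le>
          vdist V (p a n) (S a) + vdist V (p b n) (S b)"
        by simp
      then show "(\<lambda>n. vdist V (p (a \<oplus>\<^bsub>l1_space\<^esub> b) n) (S a \<oplus> S b)) \<longlonglongrightarrow> 0"
        by (rule Lim_null_comparison) (use tendsto_add[OF S_lim[OF ab(1)] S_lim[OF ab(2)]] in simp)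
    qed (use ab in auto)
    show "S (r \<odot>\<^bsub>l1_space\<^esub> a) = r \<odot> S a" if a: "a \<in> carrier l1_space" for r a
    proof (rule S_eq)
      have "vdist V (p (r \<odot>\<^bsub>l1_space\<^esub> a) n) (r \<odot> S a) = \<bar>r\<bar> * vdist V (p a n) (S a)" for n
        using a vdist_smult[of "p a n" "S a" r] by (simp add: l1_space_def p_smult)
      then show "(\<lambda>n. vdist V (p (r \<odot>\<^bsub>l1_space\<^esub> a) n) (r \<odot> S a)) \<longlonglongrightarrow> 0"
        using tendsto_mult_right_zero[OF S_lim[OF a]] by simp
    qed (use a in auto)
  qed
  moreover have "c * vnorm l1_space a \<le> vnorm V (S a) \<and> vnorm V (S a) \<le> B * vnorm l1_space a"
    if a: "a \<in> carrier l1_space" for a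
  proof
    have lim: "(\<lambda>n. \<Sum>k<n. \<bar>a k\<bar>) \<longlonglongrightarrow> vnorm l1_space a"
      using summable_LIMSEQ[of "\<lambda>k. \<bar>a k\<bar>"] a by (simp add: l1_space_def)
    \<comment> \<open>The distance from the partial sum to \<open>S a\<close> is an error term that
      tends to 0, so the finite estimate survives in the limit.\<close>
    have "c * (\<Sum>k<n. \<bar>a k\<bar>) \<le> vnorm V (S a) + vdist V (p a n) (S a)" for n
      using lower[of a n] vnorm_le_vdist[OF p_in S_in[OF a], of a n] by (simp add: p_def)
    moreover have "(\<lambda>n. vnorm V (S a) + vdist V (p a n) (S a)) \<longlonglongrightarrow> vnorm V (S a) + 0"
      by (intro tendsto_intros S_lim a)
    ultimately show "c * vnorm l1_space a \<le> vnorm V (S a)"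
      using LIMSEQ_le[OF tendsto_mult_left[OF lim, of c]] by auto
    have upper: "vnorm V (S a) \<le> B * (\<Sum>k<n. \<bar>a k\<bar>) + vdist V (p a n) (S a)" for n
    proof -
      have "vnorm V (p a n) \<le> B * (\<Sum>k<n. \<bar>a k\<bar>)"
        using p_dist[of 0 n a] vdist_add_right[of \<zero> "p a n"]
        by (simp add: p_0 lessThan_atLeast0)
      then show ?thesis
        using vnorm_le_vdist[of "S a" "p a n"] a N.commute[of "S a" "p a n"] by simp
    qed
    have "(\<lambda>n. B * (\<Sum>k<n. \<bar>a k\<bar>) + vdist V (p a n) (S a)) \<longlonglongrightarrow> B * vnorm l1_space a"
      using tendsto_add[OF tendsto_mult_left[OF lim, of B] S_lim[OF a]] by simp
    then show "vnorm V (S a) \<le> B * vnorm l1_space a"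
      by (rule LIMSEQ_le_const) (use upper in blast)
  qed
  ultimately show ?thesis
    unfolding contains_isomorphic_copy_def using c by blast
qed

lemma dual_finsum:
  assumes u: "u \<in> dual V" and w: "\<And>k. w k \<in> carrier V"
  shows "u (\<Oplus>k\<in>{..<n :: nat}. r k \<odot> w k) = (\<Sum>k<n. r k * u (w k))"
proof (induction n)
  case 0
  \<comment> \<open>Vanishing at zero is not a clause of \<open>dual\<close>; it comes from
    homogeneity with scalar 0.\<close>
  have "u (0 \<odot> \<zero>) = 0 * u \<zero>"
    using u M.zero_closed unfolding dual_def by blast
  then show ?case
    using smult_l_null[of \<zero>] by simp
next
  case (Suc n)
  have "(\<Oplus>k\<in>{..<n}. r k \<odot> w k) \<in> carrier V"
    using w by (intro M.finsum_closed) auto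
  moreover have "(\<Oplus>k\<in>{..<Suc n}. r k \<odot> w k) = r n \<odot> w n \<oplus> (\<Oplus>k\<in>{..<n}. r k \<odot> w k)"
    unfolding lessThan_Suc using w by (subst M.finsum_insert) (auto simp: Pi_iff)
  ultimately show ?case
    using Suc u w by (simp add: dual_def)
qed

text \<open>
  Here \<open>u s\<close> plays the role of a point of an independent family: given coefficients, one compares
  the functional for the set of indices of nonnegative coefficients with that for its complement.
\<close>

lemma contains_l1_if_independent:
  fixes w :: "nat \<Rightarrow> 'v"
  assumes complete: "N.mcomplete"
    and w: "\<And>n. w n \<in> carrier V" and B: "\<And>n. vnorm V (w n) \<le> B"
    and u: "\<And>s. u s \<in> dual V" and C: "\<And>s. dual_norm V (u s) \<le> C"
    and upper: "\<And>s n. s n \<Longrightarrow> b \<le> u s (w n)" and lower: "\<And>s n. \<not> s n \<Longrightarrow> u s (w n) \<le> a"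
    and ab: "a < b"
  shows "contains_isomorphic_copy V l1_space"
proof (rule contains_l1_if_lower_estimate[OF complete w B])
  \<comment> \<open>\<open>D\<close> is at least \<open>C\<close> and positive whatever the sign of
    \<open>C\<close>, so it can serve as a divisor.\<close>
  define D where "D = \<bar>C\<bar> + 1"
  have D: "D > 0" "C \<le> D"
    by (auto simp: D_def)
  show "(b - a) / (2 * D) > 0"
    using ab D by simp
  fix r :: "nat \<Rightarrow> real" and n :: nat
  define v where "v = (\<Oplus>k\<in>{..<n}. r k \<odot> w k)"
  have v: "v \<in> carrier V"
    unfolding v_def using w by (intro M.finsum_closed) auto
  have uv: "\<bar>u s v\<bar> \<le> D * vnorm V v" for s
    using dual_norm_bound[OF u v, of s] mult_right_mono[OF order_trans[OF C D(2)] vnorm_ge_0[OF v], of s]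
    by linarith
  define s where "s k \<longleftrightarrow> r k \<ge> 0" for k
  define t where "t k \<longleftrightarrow> r k < 0" for k
  \<comment> \<open>No cancellation occurs: the difference of the two functionals at
    \<open>w k\<close> is at least \<open>b - a\<close> where \<open>r k\<close> is nonnegative and
    at most \<open>a - b\<close> where it is negative. Summing bounds the difference at
    \<open>v\<close> from below, while \<open>D\<close> bounds it from above.\<close>
  have "(b - a) * (\<Sum>k<n. \<bar>r k\<bar>) = (\<Sum>k<n. (b - a) * \<bar>r k\<bar>)"
    by (simp add: sum_distrib_left)
  also have "\<dots> \<le> (\<Sum>k<n. r k * (u s (w k) - u t (w k)))"
  proof (rule sum_mono)
    fix k
    show "(b - a) * \<bar>r k\<bar> \<le> r k * (u s (w k) - u t (w k))"
    proof (cases "r k \<ge> 0")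
      case True
      then have "b - a \<le> u s (w k) - u t (w k)"
        using upper[of s k] lower[of t k] by (simp add: s_def t_def)
      then show ?thesis
        using True mult_left_mono[of "b - a" "u s (w k) - u t (w k)" "r k"] by (simp add: mult.commute)
    next
      case False
      then have "b - a \<le> u t (w k) - u s (w k)"
        using upper[of t k] lower[of s k] by (simp add: s_def t_def)
      then show ?thesis
        using False mult_left_mono[of "b - a" "u t (w k) - u s (w k)" "- r k"]
        by (simp add: algebra_simps)
    qed
  qed
  also have "\<dots> = u s v - u t v"
    by (simp add: v_def dual_finsum[OF u w] algebra_simps sum_subtractf)
  also have "\<dots> \<le> 2 * D * vnorm V v"
    using uv[of s] uv[of t] by linarith
  finally show "(b - a) / (2 * D) * (\<Sum>k<n. \<bar>r k\<bar>) \<le> vnorm V (\<Oplus>k\<in>{..<n}. r k \<odot> w k)"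
    using D(1) by (simp add: field_simps flip: v_def)
qed

end


section \<open>Countable products of discrete spaces\<close>

text \<open>A basic open set restricts finitely many coordinates, all below some \<open>N\<close>;
  conversely, singletons are open in discrete factors, so prescribing an initial segment is an open
  condition. Topological claims about the group thereby become statements about finitely many
  coordinates.\<close>

lemma openin_product_discrete_iff:
  fixes A :: "nat \<Rightarrow> 'a set"
  shows "openin (product_topology (\<lambda>i. discrete_topology (A i)) UNIV) U \<longleftrightarrow>
    U \<subseteq> Pi UNIV A \<and> (\<forall>x\<in>U. \<exists>N. \<forall>y\<in>Pi UNIV A. (\<forall>i<N. y i = x i) \<longrightarrow> y \<in> U)"
    (is "openin ?T U \<longleftrightarrow> ?R")
proof
  assume U: "openin ?T U"
  have "\<exists>N. \<forall>y\<in>Pi UNIV A. (\<forall>i<N. y i = x i) \<longrightarrow> y \<in> U" if x: "x \<in> U" for x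
  proof -
    obtain B where B: "finite {i. B i \<noteq> A i}" "x \<in> Pi UNIV B" "Pi UNIV B \<subseteq> U"
      using U x by (auto simp: openin_product_topology_alt PiE_UNIV_domain)
    obtain N where N: "{i. B i \<noteq> A i} \<subseteq> {..<N}"
      using B(1) finite_nat_iff_bounded by blast
    have "y \<in> U" if "y \<in> Pi UNIV A" "\<forall>i<N. y i = x i" for y
    proof -
      have "y i \<in> B i" for i
        using that B(2) N by (cases "i < N"; cases "B i = A i") (auto simp: Pi_iff)
      then show ?thesis
        using B(3) by auto
    qed
    then show ?thesis by blast
  qed
  moreover have "U \<subseteq> Pi UNIV A"
    using openin_subset[OF U] by (simp add: PiE_UNIV_domain)
  ultimately show ?R by blast
next
  assume R: ?R
  show "openin ?T U"
    unfolding openin_product_topology_alt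
  proof (intro ballI)
    fix x assume x: "x \<in> U"
    with R obtain N where N: "\<forall>y\<in>Pi UNIV A. (\<forall>i<N. y i = x i) \<longrightarrow> y \<in> U"
      by meson
    define B where "B i = (if i < N then {x i} else A i)" for i
    have "{i. B i \<noteq> A i} \<subseteq> {..<N}"
      by (auto simp: B_def)
    then have "finite {i. B i \<noteq> A i}"
      using finite_subset by blast
    moreover have "B i \<subseteq> A i" "x i \<in> B i" for i
      using R x by (auto simp: B_def)
    moreover have "Pi UNIV B \<subseteq> U"
    proof
      fix y assume y: "y \<in> Pi UNIV B"
      show "y \<in> U"
      proof (rule N[rule_format])
        show "y \<in> Pi UNIV A"
          using y calculation(2) by fast
        show "y i = x i" if "i < N" for i
          using that y by (auto simp: B_def Pi_iff split: if_splits)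
      qed
    qed
    ultimately show "\<exists>B. finite {i \<in> UNIV. B i \<noteq> topspace (discrete_topology (A i))} \<and>
        (\<forall>i\<in>UNIV. openin (discrete_topology (A i)) (B i)) \<and> x \<in> Pi\<^sub>E UNIV B \<and> Pi\<^sub>E UNIV B \<subseteq> U"
      by (intro exI[of _ B]) (simp add: PiE_UNIV_domain Pi_iff)
  qed
qed

text \<open>The eventually zero sequences are countable, being coded by finite lists, and dense,
  since cutting off a point late enough stays inside any given neighbourhood.\<close>

lemma separable_space_product_discrete:
  fixes A :: "nat \<Rightarrow> nat set"
  assumes 0: "\<And>i. 0 \<in> A i"
  shows "separable_space (product_topology (\<lambda>i. discrete_topology (A i)) UNIV)" (is "separable_space ?T")
proof -
  define D where "D = {x \<in> Pi UNIV A. \<exists>N. \<forall>i\<ge>N. x i = 0}"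
  have "D \<subseteq> range (\<lambda>l i. if i < length l then l ! i else 0)"
  proof
    fix x assume "x \<in> D"
    then obtain N where "\<forall>i\<ge>N. x i = 0"
      by (auto simp: D_def)
    then have "x = (\<lambda>l i. if i < length l then l ! i else 0) (map x [0..<N])"
      by (auto simp: fun_eq_iff)
    then show "x \<in> range (\<lambda>l i. if i < length l then l ! i else 0)"
      by blast
  qed
  then have "countable D"
    by (rule countable_subset) simp
  moreover have "Pi UNIV A \<subseteq> ?T closure_of D"
  proof
    fix x assume x: "x \<in> Pi UNIV A"
    have "\<exists>y. y \<in> D \<and> y \<in> U" if U: "x \<in> U" "openin ?T U" for U
    proof -
      obtain N where N: "\<forall>y\<in>Pi UNIV A. (\<forall>i<N. y i = x i) \<longrightarrow> y \<in> U"
        using U unfolding openin_product_discrete_iff by blast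
      have "(\<lambda>i. if i < N then x i else 0) \<in> D"
        using x 0 by (auto simp: D_def intro: exI[of _ N])
      moreover have "(\<lambda>i. if i < N then x i else 0) \<in> U"
        using x 0 by (intro N[rule_format]) auto
      ultimately show ?thesis by blast
    qed
    then show "x \<in> ?T closure_of D"
      using x by (auto simp: in_closure_of PiE_UNIV_domain)
  qed
  moreover have "D \<subseteq> topspace ?T"
    by (auto simp: D_def PiE_UNIV_domain)
  ultimately show ?thesis
    unfolding separable_space_def
    using closure_of_subset_topspace[of ?T D] by (auto simp: PiE_UNIV_domain)
qed


section \<open>A lamplighter group\<close>

text \<open>
  The elements are the pairs of a position \<open>f 0\<close> in the group of natural numbers under \<open>XOR\<close>, which
  is a direct sum of countably many groups of order 2, and a configuration of lamps
  \<open>f (Suc i) \<in> {0, 1}\<close> indexed by that same group, which acts on them by translation.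
\<close>

definition lamp_values :: "nat \<Rightarrow> nat set" where
  "lamp_values i = (if i = 0 then UNIV else {0, 1})"

text \<open>This is the semidirect product law: positions add, and the second configuration is
  translated by the first position before the lamps are added. Since \<open>XOR\<close> has exponent
  2, translation by a position and by its inverse coincide.\<close>

definition lamplighter :: "(nat \<Rightarrow> nat) monoid" where
  "lamplighter = \<lparr>carrier = Pi UNIV lamp_values,
     mult = (\<lambda>f g. case_nat (f 0 XOR g 0) (\<lambda>i. f (Suc i) XOR g (Suc (i XOR f 0)))),
     one = (\<lambda>_. 0)\<rparr>"

definition lamplighter_topology :: "(nat \<Rightarrow> nat) topology" where
  "lamplighter_topology = product_topology (\<lambda>i. discrete_topology (lamp_values i)) UNIV"

lemma carrier_lamplighter_iff: "f \<in> carrier lamplighter \<longleftrightarrow> (\<forall>i. f (Suc i) = 0 \<or> f (Suc i) = 1)"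
proof -
  have "f \<in> carrier lamplighter \<longleftrightarrow> (\<forall>i. f i \<in> lamp_values i)"
    by (simp add: lamplighter_def Pi_iff)
  also have "\<dots> \<longleftrightarrow> (\<forall>i. f (Suc i) = 0 \<or> f (Suc i) = 1)"
    unfolding lamp_values_def by (metis UNIV_I insert_iff nat.exhaust nat.distinct(1) singletonD)
  finally show ?thesis .
qed

lemma mult_lamplighter:
  "(f \<otimes>\<^bsub>lamplighter\<^esub> g) 0 = f 0 XOR g 0"
  "(f \<otimes>\<^bsub>lamplighter\<^esub> g) (Suc i) = f (Suc i) XOR g (Suc (i XOR f 0))"
  by (simp_all add: lamplighter_def)

lemma one_lamplighter: "\<one>\<^bsub>lamplighter\<^esub> i = 0"
  by (simp add: lamplighter_def)

lemmas lamplighter_simps = carrier_lamplighter_iff mult_lamplighter one_lamplighter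

lemma nat_fun_eqI: "f 0 = g 0 \<Longrightarrow> (\<And>i. f (Suc i) = g (Suc i)) \<Longrightarrow> f = g" for f g :: "nat \<Rightarrow> 'a"
  by (metis ext not0_implies_Suc)

lemma mult_in_lamplighter:
  assumes "f \<in> carrier lamplighter" "g \<in> carrier lamplighter"
  shows "f \<otimes>\<^bsub>lamplighter\<^esub> g \<in> carrier lamplighter"
  unfolding carrier_lamplighter_iff
proof
  fix i
  have "f (Suc i) = 0 \<or> f (Suc i) = 1" "g (Suc (i XOR f 0)) = 0 \<or> g (Suc (i XOR f 0)) = 1"
    using assms by (simp_all only: carrier_lamplighter_iff)
  then show "(f \<otimes>\<^bsub>lamplighter\<^esub> g) (Suc i) = 0 \<or> (f \<otimes>\<^bsub>lamplighter\<^esub> g) (Suc i) = 1"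
    by (auto simp: mult_lamplighter)
qed

text \<open>Positions and configurations are their own inverses, so inverting a pair only translates
  its configuration by its position.\<close>

lemma left_inverse_lamplighter:
  "case_nat (f 0) (\<lambda>i. f (Suc (i XOR f 0))) \<otimes>\<^bsub>lamplighter\<^esub> f = \<one>\<^bsub>lamplighter\<^esub>"
  by (rule nat_fun_eqI) (simp_all add: lamplighter_simps)

lemma inverse_in_lamplighter:
  "f \<in> carrier lamplighter \<Longrightarrow> case_nat (f 0) (\<lambda>i. f (Suc (i XOR f 0))) \<in> carrier lamplighter"
  by (simp add: carrier_lamplighter_iff)

lemma group_lamplighter: "group lamplighter"
proof (rule groupI)
  show "f \<otimes>\<^bsub>lamplighter\<^esub> g \<otimes>\<^bsub>lamplighter\<^esub> h = f \<otimes>\<^bsub>lamplighter\<^esub> (g \<otimes>\<^bsub>lamplighter\<^esub> h)" for f g h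
    by (rule nat_fun_eqI) (simp_all add: lamplighter_simps xor.assoc)
  show "\<one>\<^bsub>lamplighter\<^esub> \<otimes>\<^bsub>lamplighter\<^esub> f = f" for f
    by (rule nat_fun_eqI) (simp_all add: lamplighter_simps)
  show "\<exists>g\<in>carrier lamplighter. g \<otimes>\<^bsub>lamplighter\<^esub> f = \<one>\<^bsub>lamplighter\<^esub>"
    if "f \<in> carrier lamplighter" for f
    using left_inverse_lamplighter inverse_in_lamplighter[OF that] by blast
qed (simp_all add: mult_in_lamplighter carrier_lamplighter_iff[of "\<one>\<^bsub>lamplighter\<^esub>"] one_lamplighter)

interpretation lamplighter: group lamplighter
  by (rule group_lamplighter)

lemma inv_lamplighter:
  assumes "f \<in> carrier lamplighter"
  shows "inv\<^bsub>lamplighter\<^esub> f = case_nat (f 0) (\<lambda>i. f (Suc (i XOR f 0)))"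
  by (rule lamplighter.inv_equality[OF left_inverse_lamplighter assms inverse_in_lamplighter[OF assms]])

section \<open>Topological properties of the lamplighter group\<close>

lemma topspace_lamplighter_topology [simp]: "topspace lamplighter_topology = carrier lamplighter"
  by (simp add: lamplighter_topology_def lamplighter_def PiE_UNIV_domain)

lemma openin_lamplighter_iff:
  "openin lamplighter_topology U \<longleftrightarrow> U \<subseteq> carrier lamplighter \<and>
    (\<forall>f\<in>U. \<exists>N. \<forall>g\<in>carrier lamplighter. (\<forall>i<N. g i = f i) \<longrightarrow> g \<in> U)"
  by (simp add: lamplighter_topology_def lamplighter_def openin_product_discrete_iff)

lemma openin_lamplighterE:
  assumes "openin lamplighter_topology U" "f \<in> U"
  obtains N where "\<And>g. g \<in> carrier lamplighter \<Longrightarrow> \<forall>i<N. g i = f i \<Longrightarrow> g \<in> U"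
  using assms unfolding openin_lamplighter_iff by metis

lemma openin_cylinder_lamplighter:
  "openin lamplighter_topology {g \<in> carrier lamplighter. \<forall>i<N. g i = f i}"
  unfolding openin_lamplighter_iff by (auto intro!: exI[of _ N])

text \<open>Translation by \<open>k\<close> does not respect the order of the lamps, but it moves
  finitely many lamps to finitely many lamps. For a fixed position, an initial segment of a product
  or an inverse thus depends on bounded initial segments of the arguments.\<close>

lemma XOR_bounded: "\<exists>M. \<forall>i. Suc i < N \<longrightarrow> i XOR k < M" for k N :: nat
proof -
  have "finite ((\<lambda>i. i XOR k) ` {..<N})"
    by simp
  then show ?thesis
    by (auto simp: finite_nat_set_iff_bounded dest: Suc_lessD)
qed

text \<open>The position is a discrete coordinate, so near \<open>(f, g)\<close> the translation
  applied to the second factor is constantly the one by \<open>f 0\<close>.\<close>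

lemma continuous_mult_lamplighter:
  "continuous_map (prod_topology lamplighter_topology lamplighter_topology) lamplighter_topology
    (\<lambda>(f, g). f \<otimes>\<^bsub>lamplighter\<^esub> g)"
  unfolding continuous_map_def
proof (intro conjI allI impI)
  fix U assume U: "openin lamplighter_topology U"
  show "openin (prod_topology lamplighter_topology lamplighter_topology)
      {p \<in> topspace (prod_topology lamplighter_topology lamplighter_topology).
        (case p of (f, g) \<Rightarrow> f \<otimes>\<^bsub>lamplighter\<^esub> g) \<in> U}" (is "openin ?T ?P")
    unfolding openin_prod_topology_alt
  proof (intro allI impI)
    fix f g assume "(f, g) \<in> ?P"
    then have fg: "f \<in> carrier lamplighter" "g \<in> carrier lamplighter" "f \<otimes>\<^bsub>lamplighter\<^esub> g \<in> U"
      by auto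
    obtain N where N: "\<And>h. h \<in> carrier lamplighter \<Longrightarrow>
        \<forall>i<N. h i = (f \<otimes>\<^bsub>lamplighter\<^esub> g) i \<Longrightarrow> h \<in> U"
      using openin_lamplighterE[OF U fg(3)] by blast
    obtain M where M: "\<forall>i. Suc i < N \<longrightarrow> i XOR f 0 < M"
      using XOR_bounded by blast
    \<comment> \<open>Lamp \<open>j\<close> sits at coordinate \<open>Suc j\<close>. Agreement below
      \<open>Suc M\<close> therefore fixes the position and all lamps below
      \<open>M\<close>.\<close>
    define F where "F = {h \<in> carrier lamplighter. \<forall>i<Suc N. h i = f i}"
    define H where "H = {h \<in> carrier lamplighter. \<forall>i<Suc M. h i = g i}"
    have "f' \<otimes>\<^bsub>lamplighter\<^esub> g' \<in> U" if f': "f' \<in> F" and g': "g' \<in> H" for f' g'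
    proof (rule N)
      show "f' \<otimes>\<^bsub>lamplighter\<^esub> g' \<in> carrier lamplighter"
        using that by (auto simp: F_def H_def intro: mult_in_lamplighter)
      show "\<forall>i<N. (f' \<otimes>\<^bsub>lamplighter\<^esub> g') i = (f \<otimes>\<^bsub>lamplighter\<^esub> g) i"
      proof (intro allI impI)
        fix i assume i: "i < N"
        show "(f' \<otimes>\<^bsub>lamplighter\<^esub> g') i = (f \<otimes>\<^bsub>lamplighter\<^esub> g) i"
        proof (cases i)
          case 0
          then show ?thesis
            using f' g' by (simp add: F_def H_def mult_lamplighter)
        next
          case (Suc j)
          moreover have "g' (Suc (j XOR f 0)) = g (Suc (j XOR f 0))"
            using g' M i Suc by (simp add: H_def)
          ultimately show ?thesis
            using f' i by (simp add: F_def mult_lamplighter)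
        qed
      qed
    qed
    moreover have "f \<in> F" "g \<in> H" "F \<subseteq> carrier lamplighter" "H \<subseteq> carrier lamplighter"
      using fg by (auto simp: F_def H_def)
    moreover have "openin lamplighter_topology F" "openin lamplighter_topology H"
      unfolding F_def H_def by (rule openin_cylinder_lamplighter)+
    ultimately show "\<exists>F H. openin lamplighter_topology F \<and> openin lamplighter_topology H \<and>
        f \<in> F \<and> g \<in> H \<and> F \<times> H \<subseteq> ?P"
      by (intro exI[of _ F] exI[of _ H]) auto
  qed
qed (auto intro: mult_in_lamplighter)

lemma continuous_inv_lamplighter:
  "continuous_map lamplighter_topology lamplighter_topology (\<lambda>f. inv\<^bsub>lamplighter\<^esub> f)"
  unfolding continuous_map_def
proof (intro conjI allI impI)
  fix U assume U: "openin lamplighter_topology U"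
  let ?P = "{f \<in> topspace lamplighter_topology. inv\<^bsub>lamplighter\<^esub> f \<in> U}"
  show "openin lamplighter_topology ?P"
    unfolding openin_lamplighter_iff
  proof (intro conjI ballI)
    fix f assume "f \<in> ?P"
    then have f: "f \<in> carrier lamplighter" "inv\<^bsub>lamplighter\<^esub> f \<in> U"
      by auto
    obtain N where N: "\<And>h. h \<in> carrier lamplighter \<Longrightarrow>
        \<forall>i<N. h i = (inv\<^bsub>lamplighter\<^esub> f) i \<Longrightarrow> h \<in> U"
      using openin_lamplighterE[OF U f(2)] by blast
    obtain M where M: "\<forall>i. Suc i < N \<longrightarrow> i XOR f 0 < M"
      using XOR_bounded by blast
    \<comment> \<open>Agreement below \<open>Suc M\<close> includes coordinate 0, so
      \<open>g\<close> and \<open>f\<close> are inverted with the same translation.\<close>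
    have "inv\<^bsub>lamplighter\<^esub> g \<in> U" if g: "g \<in> carrier lamplighter" "\<forall>i<Suc M. g i = f i" for g
    proof (rule N)
      show "inv\<^bsub>lamplighter\<^esub> g \<in> carrier lamplighter"
        using g(1) by simp
      have "g 0 = f 0" "\<And>i. Suc i < N \<Longrightarrow> g (Suc (i XOR f 0)) = f (Suc (i XOR f 0))"
        using g(2) M by simp_all
      then show "\<forall>i<N. (inv\<^bsub>lamplighter\<^esub> g) i = (inv\<^bsub>lamplighter\<^esub> f) i"
        using g(1) f(1) by (auto simp: inv_lamplighter split: nat.split)
    qed
    then show "\<exists>N. \<forall>g\<in>carrier lamplighter. (\<forall>i<N. g i = f i) \<longrightarrow> g \<in> ?P"
      by (intro exI[of _ "Suc M"]) simp
  qed auto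
qed auto

lemma Polish_space_lamplighter: "Polish_space lamplighter_topology"
  unfolding Polish_space_def lamplighter_topology_def
proof
  show "separable_space (product_topology (\<lambda>i. discrete_topology (lamp_values i)) UNIV)"
    by (rule separable_space_product_discrete) (simp add: lamp_values_def)
  show "completely_metrizable_space (product_topology (\<lambda>i. discrete_topology (lamp_values i)) UNIV)"
    by (simp add: completely_metrizable_space_product_topology
        completely_metrizable_space_discrete_topology)
qed

lemma topological_group_lamplighter: "topological_group lamplighter lamplighter_topology"
proof
  have "metrizable_space lamplighter_topology"
    using Polish_space_lamplighter
    by (simp add: Polish_space_def completely_metrizable_imp_metrizable_space)
  then show "tychonoff_space lamplighter_topology"
    by (simp add: tychonoff_space_def metrizable_imp_completely_regular_space
        metrizable_imp_Hausdorff_space)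
qed (simp_all add: continuous_mult_lamplighter continuous_inv_lamplighter)

text \<open>The lamp factors are finite, so the only noncompact factor is the discrete space of
  positions, which is locally compact.\<close>

lemma locally_compact_space_lamplighter: "locally_compact_space lamplighter_topology"
proof -
  have "{i. \<not> compact_space (discrete_topology (lamp_values i))} \<subseteq> {0}"
    by (auto simp: lamp_values_def compact_space_discrete_topology)
  then have "finite {i. \<not> compact_space (discrete_topology (lamp_values i))}"
    using finite_subset by blast
  then show ?thesis
    by (simp add: lamplighter_topology_def locally_compact_space_product_topology
        locally_compact_space_discrete_topology)
qed

lemma non_archimedean_lamplighter: "non_archimedean lamplighter lamplighter_topology"
  unfolding non_archimedean_def
proof (intro allI impI)
  fix U assume "openin lamplighter_topology U \<and> \<one>\<^bsub>lamplighter\<^esub> \<in> U"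
  then obtain N where N: "\<And>g. g \<in> carrier lamplighter \<Longrightarrow> \<forall>i<N. g i = 0 \<Longrightarrow> g \<in> U"
    unfolding openin_lamplighter_iff by (metis one_lamplighter)
  \<comment> \<open>The bound \<open>Suc N\<close> forces position 0 even if \<open>N = 0\<close>.
    At position 0 no translation takes place and multiplication is coordinatewise
    \<open>XOR\<close>, under which a cylinder around the identity is closed.\<close>
  define H where "H = {g \<in> carrier lamplighter. \<forall>i<Suc N. g i = 0}"
  have mult: "f \<otimes>\<^bsub>lamplighter\<^esub> g \<in> H" if f: "f \<in> H" and g: "g \<in> H" for f g
  proof -
    have "(f \<otimes>\<^bsub>lamplighter\<^esub> g) i = 0" if "i < Suc N" for i
      using f g that by (cases i) (simp_all add: H_def mult_lamplighter)
    then show ?thesis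
      using f g by (simp add: H_def mult_in_lamplighter)
  qed
  have inv: "inv\<^bsub>lamplighter\<^esub> f \<in> H" if f: "f \<in> H" for f
  proof -
    have "(inv\<^bsub>lamplighter\<^esub> f) i = 0" if "i < Suc N" for i
      using f that by (cases i) (simp_all add: H_def inv_lamplighter)
    then show ?thesis
      using f by (simp add: H_def)
  qed
  have "\<one>\<^bsub>lamplighter\<^esub> \<in> H"
    by (simp add: H_def one_lamplighter)
  then have "subgroup H lamplighter"
    using mult inv by (intro lamplighter.subgroupI) (auto simp: H_def)
  moreover have "openin lamplighter_topology H"
    unfolding H_def by (rule openin_cylinder_lamplighter)
  moreover have "H \<subseteq> U"
    using N by (auto simp: H_def)
  ultimately show "\<exists>H. subgroup H lamplighter \<and> openin lamplighter_topology H \<and> H \<subseteq> U"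
    by blast
qed

section \<open>Conjugation as a Bernoulli shift, and failure of representability\<close>

lemma conjugation_lamplighter:
  assumes "y \<in> carrier lamplighter" "y 0 = 0"
  shows "conjugation lamplighter (case_nat m (\<lambda>_. 0)) y = case_nat 0 (\<lambda>i. y (Suc (i XOR m)))"
proof -
  have "case_nat m (\<lambda>_. 0) \<in> carrier lamplighter"
    by (simp add: carrier_lamplighter_iff)
  \<comment> \<open>An element with all lamps off is its own inverse: its position has order at most
    2.\<close>
  then have "conjugation lamplighter (case_nat m (\<lambda>_. 0)) y =
      case_nat m (\<lambda>_. 0) \<otimes>\<^bsub>lamplighter\<^esub> y \<otimes>\<^bsub>lamplighter\<^esub> case_nat m (\<lambda>_. 0)"
    using assms(1) by (simp add: conjugation_def inv_lamplighter cong: nat.case_cong)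
  also have "\<dots> = case_nat 0 (\<lambda>i. y (Suc (i XOR m)))"
    using assms(2) by (intro nat_fun_eqI) (simp_all add: mult_lamplighter)
  finally show ?thesis .
qed

text \<open>The low \<open>N\<close> bits of \<open>n * 2 ^ N\<close> vanish and \<open>i\<close>
  has no others, so no bits interact. Translation by \<open>n * 2 ^ N\<close> thus carries the lamps
  below \<open>2 ^ N\<close> into the \<open>n\<close>-th block of length \<open>2 ^ N\<close>, and
  these blocks are disjoint.\<close>

lemma XOR_mult_power_div: "(i XOR n * 2 ^ N) div 2 ^ N = n" if "i < 2 ^ N" for i n N :: nat
proof -
  have "(i XOR n * 2 ^ N) div 2 ^ N = drop_bit N (i XOR push_bit N n)"
    by (simp add: drop_bit_eq_div push_bit_eq_mult)
  also have "\<dots> = drop_bit N i XOR n"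
    by (simp add: drop_bit_push_bit)
  also have "\<dots> = n"
    using that by (simp add: drop_bit_eq_div)
  finally show ?thesis .
qed

lemma not_rosenthal_representable_lamplighter:
  "\<not> rosenthal_representable lamplighter lamplighter_topology lamplighter_topology
    (conjugation lamplighter)"
proof
  assume "rosenthal_representable lamplighter lamplighter_topology lamplighter_topology
    (conjugation lamplighter)"
  then obtain V :: "(nat \<Rightarrow> nat, nat \<Rightarrow> nat) universe normed_space" and h \<alpha>
    where ros: "rosenthal_space V"
      and rep: "proper_representation lamplighter lamplighter_topology lamplighter_topology
        (conjugation lamplighter) V h \<alpha>"
    unfolding rosenthal_representable_def by blast
  interpret real_normed_space V
    using ros by (simp add: rosenthal_space_def banach_space_def)
  have h: "h \<in> hom lamplighter (iso_group V)"
    and cont: "continuous_map lamplighter_topology (weak_star_topology V) \<alpha>"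
    and bdd: "\<exists>C. \<forall>x\<in>carrier lamplighter. dual_norm V (\<alpha> x) \<le> C"
    and equi: "\<And>g x. g \<in> carrier lamplighter \<Longrightarrow> x \<in> carrier lamplighter \<Longrightarrow>
      \<alpha> (conjugation lamplighter g x) = dual_action V (h g) (\<alpha> x)"
    and emb: "embedding_map lamplighter_topology (weak_star_topology V) \<alpha>"
    using rep by (auto simp: proper_representation_def representation_def)
  have inj: "inj_on \<alpha> (carrier lamplighter)"
    using emb by (simp add: embedding_map_def homeomorphic_eq_everything_map)
  have \<alpha>_dual: "\<alpha> x \<in> dual V" if "x \<in> carrier lamplighter" for x
    using cont that by (auto simp: weak_star_topology_def continuous_map_in_subtopology)
  have \<alpha>_cont: "continuous_map lamplighter_topology euclideanreal (\<lambda>x. \<alpha> x v)" if "v \<in> carrier V" for v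
    using cont that by (auto simp: weak_star_topology_def continuous_map_in_subtopology
        continuous_map_componentwise)

  define p :: "nat \<Rightarrow> nat" where "p = case_nat 0 (\<lambda>_. 0)"
  define q :: "nat \<Rightarrow> nat" where "q = case_nat 0 (\<lambda>_. 1)"
  have pq: "p \<in> carrier lamplighter" "q \<in> carrier lamplighter"
    by (simp_all add: p_def q_def carrier_lamplighter_iff)
  have "p (Suc 0) \<noteq> q (Suc 0)"
    by (simp add: p_def q_def)
  then have "\<alpha> p \<noteq> \<alpha> q"
    using inj pq by (metis inj_onD)
  \<comment> \<open>Extensional functions that differ must differ at a vector of the
    carrier.\<close>
  moreover have "\<alpha> p \<in> extensional (carrier V)" "\<alpha> q \<in> extensional (carrier V)"
    using \<alpha>_dual pq by (auto simp: dual_def)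
  ultimately obtain v0 where v0: "v0 \<in> carrier V" "\<alpha> p v0 \<noteq> \<alpha> q v0"
    by (meson extensionalityI)
  \<comment> \<open>Replacing \<open>v0\<close> by its negative, if necessary, puts the two values
    in this order.\<close>
  have "\<exists>v\<in>carrier V. \<alpha> p v < \<alpha> q v"
  proof (cases "\<alpha> p v0 < \<alpha> q v0")
    case False
    have "\<alpha> x ((- 1) \<odot>\<^bsub>V\<^esub> v0) = - \<alpha> x v0" if "x \<in> carrier lamplighter" for x
      using \<alpha>_dual[OF that] v0(1) by (simp add: dual_def)
    then show ?thesis
      using False v0 pq by (intro bexI[of _ "(- 1) \<odot>\<^bsub>V\<^esub> v0"]) auto
  qed (use v0 in blast)
  then obtain v where v: "v \<in> carrier V" "\<alpha> p v < \<alpha> q v"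
    by blast
  \<comment> \<open>Two thresholds are chosen, not one: the gap \<open>b - a\<close> enters the
    constant of the lower \<open>l1\<close> estimate.\<close>
  then obtain a where a: "\<alpha> p v < a" "a < \<alpha> q v"
    using dense by blast
  then obtain b where b: "a < b" "b < \<alpha> q v"
    using dense by blast

  have "openin lamplighter_topology {x \<in> topspace lamplighter_topology. \<alpha> x v \<in> {..<a}}"
    by (rule openin_continuous_map_preimage[OF \<alpha>_cont[OF v(1)]]) simp
  moreover have "p \<in> {x \<in> topspace lamplighter_topology. \<alpha> x v \<in> {..<a}}"
    using pq a by simp
  ultimately obtain N1 where
    N1: "\<And>x. x \<in> carrier lamplighter \<Longrightarrow> \<forall>i<N1. x i = p i \<Longrightarrow>
      x \<in> {x \<in> topspace lamplighter_topology. \<alpha> x v \<in> {..<a}}"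
    by (rule openin_lamplighterE) blast
  have "openin lamplighter_topology {x \<in> topspace lamplighter_topology. \<alpha> x v \<in> {b<..}}"
    by (rule openin_continuous_map_preimage[OF \<alpha>_cont[OF v(1)]]) simp
  moreover have "q \<in> {x \<in> topspace lamplighter_topology. \<alpha> x v \<in> {b<..}}"
    using pq b by simp
  ultimately obtain N2 where
    N2: "\<And>x. x \<in> carrier lamplighter \<Longrightarrow> \<forall>i<N2. x i = q i \<Longrightarrow>
      x \<in> {x \<in> topspace lamplighter_topology. \<alpha> x v \<in> {b<..}}"
    by (rule openin_lamplighterE) blast
  define N where "N = max N1 N2"
  then have N: "N1 \<le> N" "N2 \<le> N"
    by simp_all

  \<comment> \<open>\<open>shift n\<close> is a pure translation onto block \<open>n\<close>, and
    \<open>lamps s\<close> is constant on each block, lit on block \<open>n\<close> exactly if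
    \<open>s n\<close>. Block length \<open>2 ^ N\<close> is used because \<open>XOR\<close> with
    its multiples permutes the blocks.\<close>
  define shift :: "nat \<Rightarrow> nat \<Rightarrow> nat" where "shift n = case_nat (n * 2 ^ N) (\<lambda>_. 0)" for n
  define lamps :: "(nat \<Rightarrow> bool) \<Rightarrow> nat \<Rightarrow> nat"
    where "lamps s = case_nat 0 (\<lambda>i. of_bool (s (i div 2 ^ N)))" for s
  \<comment> \<open>The inverse matches the one in \<open>dual_action\<close>: evaluating
    \<open>\<alpha> (lamps s)\<close> at \<open>w n\<close> amounts to evaluating \<alpha> at the
    translated configuration on the fixed vector \<open>v\<close>. Isometries keep the norms equal
    to that of \<open>v\<close>.\<close>
  define w where "w n = (inv\<^bsub>iso_group V\<^esub> (h (shift n))) v" for n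
  have shift_in: "shift n \<in> carrier lamplighter" for n
    by (simp add: shift_def carrier_lamplighter_iff)
  have lamps_in: "lamps s \<in> carrier lamplighter" for s
    by (simp add: lamps_def carrier_lamplighter_iff)
  have "inv\<^bsub>iso_group V\<^esub> (h (shift n)) \<in> linear_isometries V" for n
    using group.inv_closed[OF group_iso_group, of "h (shift n)"] hom_in_carrier[OF h shift_in]
    by (simp add: iso_group_def)
  then have w: "w n \<in> carrier V" "vnorm V (w n) = vnorm V v" for n
    using v(1) unfolding w_def linear_isometries_def linear_maps_def by blast+
  have \<alpha>_w: "\<alpha> (lamps s) (w n) = \<alpha> (conjugation lamplighter (shift n) (lamps s)) v" for s n
    using equi[OF shift_in lamps_in] v(1) by (simp add: dual_action_def w_def)
  have conj: "conjugation lamplighter (shift n) (lamps s) =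
      case_nat 0 (\<lambda>i. lamps s (Suc (i XOR n * 2 ^ N)))" for s n
    unfolding shift_def by (rule conjugation_lamplighter[OF lamps_in]) (simp add: lamps_def)
  \<comment> \<open>As \<open>N < 2 ^ N\<close>, the first \<open>N\<close> lamps lie in block 0,
    hence after translation all of them read the state of block \<open>n\<close>.\<close>
  have lamps_shift: "lamps s (Suc (i XOR n * 2 ^ N)) = of_bool (s n)" if "i < N" for s n i
    using XOR_mult_power_div[OF less_trans[OF that less_exp], of n] by (simp add: lamps_def)
  have conj_in: "conjugation lamplighter (shift n) (lamps s) \<in> carrier lamplighter" for n s
    using shift_in lamps_in by (simp add: conjugation_def)

  obtain C where C: "\<And>x. x \<in> carrier lamplighter \<Longrightarrow> dual_norm V (\<alpha> x) \<le> C"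
    using bdd by blast
  have "contains_isomorphic_copy V l1_space"
  \<comment> \<open>Independence holds because every pattern \<open>s\<close>, finite or not, is
    realised by the single configuration \<open>lamps s\<close>.\<close>
  proof (rule contains_l1_if_independent)
    show "N.mcomplete"
      using ros by (simp add: rosenthal_space_def banach_space_def)
    show "w n \<in> carrier V" "vnorm V (w n) \<le> vnorm V v" for n
      by (simp_all add: w)
    show "\<alpha> (lamps s) \<in> dual V" "dual_norm V (\<alpha> (lamps s)) \<le> C" for s
      by (simp_all add: \<alpha>_dual C lamps_in)
    show "b \<le> \<alpha> (lamps s) (w n)" if "s n" for s n
    proof -
      \<comment> \<open>Block \<open>n\<close> is lit, so the translate agrees with \<open>q\<close>
        far enough to have its value at \<open>v\<close> above \<open>b\<close>; the unlit case
        below is the same with \<open>p\<close> and \<open>a\<close>.\<close>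
      have "\<forall>i<N2. conjugation lamplighter (shift n) (lamps s) i = q i"
        using that N(2) by (simp add: q_def conj lamps_shift split: nat.split)
      then show ?thesis
        using N2[OF conj_in] by (simp add: \<alpha>_w less_imp_le)
    qed
    show "\<alpha> (lamps s) (w n) \<le> a" if "\<not> s n" for s n
    proof -
      have "\<forall>i<N1. conjugation lamplighter (shift n) (lamps s) i = p i"
        using that N(1) by (simp add: p_def conj lamps_shift split: nat.split)
      then show ?thesis
        using N1[OF conj_in] by (simp add: \<alpha>_w less_imp_le)
    qed
    show "a < b"
      by (rule b(1))
  qed
  then show False
    using ros by (simp add: rosenthal_space_def)
qed

theorem corollary3p18:
  "\<exists>(G :: (nat \<Rightarrow> nat) monoid) T.
     topological_group G T \<and> locally_compact_space T \<and> Polish_space T \<and> non_archimedean G T \<and>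
     \<not> rosenthal_representable G T T (conjugation G)"
  using topological_group_lamplighter locally_compact_space_lamplighter Polish_space_lamplighter
    non_archimedean_lamplighter not_rosenthal_representable_lamplighter
  by blast

end
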